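(* Let $\mathcal{F}\subseteq\mathcal{G}_E$ be an $\widetilde{\mathbb{R}}$-submodule, let $p:\mathcal{G}_E\to\widetilde{\mathbb{R}}$ be an $\widetilde{\mathbb{R}}$-sublinear map and let $g:\mathcal{F}\to\widetilde{\mathbb{R}}$ be an $\widetilde{\mathbb{R}}$-linear map satisfying $g(x)\le p(x)$ for all $x\in\mathcal{F}$. Assume that $\mathcal{F}$ is internal (generated by a net $(F_\varepsilon)$ of vector subspaces $F_\varepsilon\subseteq E_\varepsilon$), and that both $p$ and $g$ have representatives. Then there exists an $\widetilde{\mathbb{R}}$-linear map $f:\mathcal{G}_E\to\widetilde{\mathbb{R}}$ having representatives and satisfying $$\forall x\in\mathcal{F}:\ f(x)=g(x)\qquad\text{and}\qquad \forall x\in\mathcal{G}_E:\ f(x)\le p(x).$$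
   Context: Let $I=(0,1]$ and fix a gauge, i.e. a net $\rho=(\rho_\varepsilon)\in I^I$ with $\rho_\varepsilon\to0$ as $\varepsilon\to0^+$. All asymptotic relations are for $\varepsilon\to0^+$; "for all $\varepsilon$ small" means for all $\varepsilon\in(0,\varepsilon_0]$ for some $\varepsilon_0\in I$. $E=(E_\varepsilon,\|\cdot\|_\varepsilon)_{\varepsilon\in I}$ is a family of real normed spaces. Put $\mathcal{M}_E=\{(u_\varepsilon)\in\prod_\varepsilon E_\varepsilon\mid\exists N\in\mathbb{N}:\|u_\varepsilon\|_\varepsilon=O(\rho_\varepsilon^{-N})\}$ (moderate nets), $\mathcal{N}_E=\{(u_\varepsilon)\in\prod_\varepsilon E_\varepsilon\mid\forall N\in\mathbb{N}:\|u_\varepsilon\|_\varepsilon=O(\rho_\varepsilon^{N})\}$ (negligible nets), $\mathcal{G}_E=\mathcal{M}_E/\mathcal{N}_E$, with classes denoted $[u_\varepsilon]$. The ring $\widetilde{\mathbb{R}}$ is the case $E_\varepsilon=\mathbb{R}$ for all $\varepsilon$ (moderate and negligible nets denoted $\mathcal{M}_{\mathbb{R}},\mathcal{N}_{\mathbb{R}}$); $\mathcal{G}_E$ is an $\widetilde{\mathbb{R}}$-module with componentwise operations. Order on $\widetilde{\mathbb{R}}$: $x\le y$ iff for any representative $(x_\varepsilon)$ of $x$ there is a representative $(y_\varepsilon)$ of $y$ with $x_\varepsilon\le y_\varepsilon$ for all $\varepsilon$ small; $x<y$ iff $x\le y$ and $y-x$ is invertible; $\widetilde{\mathbb{R}}_{>0}=\{x: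 x>0\}$. A set $A\subseteq\mathcal{G}_E$ is internal, generated by $(A_\varepsilon)$, $A_\varepsilon\subseteq E_\varepsilon$, if $A=[A_\varepsilon]:=\{u\in\mathcal{G}_E\mid$ there is a representative $(u_\varepsilon)$ of $u$ with $u_\varepsilon\in A_\varepsilon$ for all $\varepsilon$ small$\}$. A map $p:\mathcal{G}_E\to\widetilde{\mathbb{R}}$ is $\widetilde{\mathbb{R}}$-sublinear if $p(\lambda u)=\lambda p(u)$ for all $\lambda\in\widetilde{\mathbb{R}}_{>0}$ and $p(u+v)\le p(u)+p(v)$; $\mathbb{R}$-sublinear maps on real vector spaces are defined in the same way. A (sub)linear map $T:\mathcal{G}_E\to\widetilde{\mathbb{R}}$ has representatives $(T_\varepsilon)$, written $T=[T_\varepsilon]$, if $T_\varepsilon:E_\varepsilon\to\mathbb{R}$ are $\mathbb{R}$-(sub)linear, $(T_\varepsilon(u_\varepsilon))\in\mathcal{M}_{\mathbb{R}}$ for all $(u_\varepsilon)\in\mathcal{M}_E$, $(T_\varepsilon(u_\varepsilon)-T_\varepsilon(v_\varepsilon))\in\mathcal{N}_{\mathbb{R}}$ whenever $(u_\varepsilon),(v_\varepsilon)\in\mathcal{M}_E$ and $(u_\varepsilon-v_\varepsilon)\in\mathcal{N}_E$, and $T([u_\varepsilon])=[T_\varepsilon(u_\varepsilon)]$. For a linear map on $\mathcal{F}=[F_\varepsilon]$ the same definition is used with $T_\varepsilon:F_\varepsilon\to\mathbb{R}$ linear and nets with $u_\varepsilon,v_\varepsilon\in F_\varepsilon$. *)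

theory Defs
  imports "HOL-Algebra.Module" "HOL-Library.Landau_Symbols"
begin

text \<open>
  The spaces \<open>E \<epsilon>\<close> of a family carry their own carriers, operations and norms. The common element
  type is no restriction, since it may be a disjoint union. The fields \<^const>\<open>monoid.mult\<close> and
  \<^const>\<open>monoid.one\<close>, which \<open>module\<close> records inherit from rings, play no role in a normed space.
\<close>

record 'a nspace = "(real, 'a) module" +
  nrm :: "'a \<Rightarrow> real"

definition real_line :: "real nspace" where
  "real_line = \<lparr>carrier = UNIV, monoid.mult = (*), one = 1, zero = 0, add = (+),
     smult = (*), nrm = abs\<rparr>"

locale normed_space = Module.module real_line X for X :: "'a nspace" (structure) +
  assumes nrm_nonneg: "x \<in> carrier X \<Longrightarrow> 0 \<le> nrm X x"
    and nrm_eq_0_iff: "x \<in> carrier X \<Longrightarrow> nrm X x = 0 \<longleftrightarrow> x = \<zero>"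
    and nrm_smult: "x \<in> carrier X \<Longrightarrow> nrm X (a \<odot> x) = \<bar>a\<bar> * nrm X x"
    and nrm_triangle: "\<lbrakk>x \<in> carrier X; y \<in> carrier X\<rbrakk> \<Longrightarrow> nrm X (x \<oplus> y) \<le> nrm X x + nrm X y"

abbreviation idx :: "real set" where
  "idx \<equiv> {0<..1}"

text \<open>
  Nets are functions on \<^typ>\<open>real\<close>; their values outside \<^const>\<open>idx\<close> are unconstrained and are
  identified by the quotient below.
\<close>

definition moderate :: "(real \<Rightarrow> real) \<Rightarrow> (real \<Rightarrow> 'a nspace) \<Rightarrow> (real \<Rightarrow> 'a) set" where
  "moderate \<rho> E = {u \<in> (\<Pi> \<epsilon>\<in>idx. carrier (E \<epsilon>)).
     \<exists>N::nat. (\<lambda>\<epsilon>. nrm (E \<epsilon>) (u \<epsilon>)) \<in> O[at_right 0](\<lambda>\<epsilon>. \<rho> \<epsilon> powi (- int N))}"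

definition negligible :: "(real \<Rightarrow> real) \<Rightarrow> (real \<Rightarrow> 'a nspace) \<Rightarrow> (real \<Rightarrow> 'a) set" where
  "negligible \<rho> E = {u \<in> (\<Pi> \<epsilon>\<in>idx. carrier (E \<epsilon>)).
     \<forall>N::nat. (\<lambda>\<epsilon>. nrm (E \<epsilon>) (u \<epsilon>)) \<in> O[at_right 0](\<lambda>\<epsilon>. \<rho> \<epsilon> ^ N)}"

definition net_rel ::
    "(real \<Rightarrow> real) \<Rightarrow> (real \<Rightarrow> 'a nspace) \<Rightarrow> ((real \<Rightarrow> 'a) \<times> (real \<Rightarrow> 'a)) set" where
  "net_rel \<rho> E = {(u, v). u \<in> moderate \<rho> E \<and> v \<in> moderate \<rho> E \<and>
     (\<lambda>\<epsilon>. u \<epsilon> \<ominus>\<^bsub>E \<epsilon>\<^esub> v \<epsilon>) \<in> negligible \<rho> E}"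

definition net_class ::
    "(real \<Rightarrow> real) \<Rightarrow> (real \<Rightarrow> 'a nspace) \<Rightarrow> (real \<Rightarrow> 'a) \<Rightarrow> (real \<Rightarrow> 'a) set" where
  "net_class \<rho> E u = net_rel \<rho> E `` {u}"

text \<open>
  In the operations on classes, all members of the union are the same class, independently of the
  chosen representatives. Multiplication and unit are irrelevant here; they are supplied in the case
  of real nets, where \<open>smult\<close> of the resulting ring coincides with its multiplication.
\<close>

definition gen_space :: "(real \<Rightarrow> real) \<Rightarrow> (real \<Rightarrow> 'a nspace) \<Rightarrow>
    ((real \<Rightarrow> real) set, (real \<Rightarrow> 'a) set) module" where
  "gen_space \<rho> E = \<lparr>carrier = moderate \<rho> E // net_rel \<rho> E,
     monoid.mult = undefined, one = undefined,
     zero = net_class \<rho> E (\<lambda>\<epsilon>. \<zero>\<^bsub>E \<epsilon>\<^esub>),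
     add = (\<lambda>U V. \<Union>u\<in>U. \<Union>v\<in>V. net_class \<rho> E (\<lambda>\<epsilon>. u \<epsilon> \<oplus>\<^bsub>E \<epsilon>\<^esub> v \<epsilon>)),
     smult = (\<lambda>A U. \<Union>a\<in>A. \<Union>u\<in>U. net_class \<rho> E (\<lambda>\<epsilon>. a \<epsilon> \<odot>\<^bsub>E \<epsilon>\<^esub> u \<epsilon>))\<rparr>"

abbreviation real_nets :: "real \<Rightarrow> real nspace" where
  "real_nets \<equiv> (\<lambda>_. real_line)"

definition gen_real ::
    "(real \<Rightarrow> real) \<Rightarrow> ((real \<Rightarrow> real) set, (real \<Rightarrow> real) set) module" where
  "gen_real \<rho> = (gen_space \<rho> real_nets)
     \<lparr>monoid.mult := (\<lambda>A B. \<Union>a\<in>A. \<Union>b\<in>B. net_class \<rho> real_nets (\<lambda>\<epsilon>. a \<epsilon> * b \<epsilon>)),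
      one := net_class \<rho> real_nets (\<lambda>_. 1)\<rparr>"

definition gen_le :: "(real \<Rightarrow> real) set \<Rightarrow> (real \<Rightarrow> real) set \<Rightarrow> bool" where
  "gen_le X Y \<longleftrightarrow> (\<forall>x\<in>X. \<exists>y\<in>Y. \<forall>\<^sub>F \<epsilon> in at_right 0. x \<epsilon> \<le> y \<epsilon>)"

definition gen_less ::
    "(real \<Rightarrow> real) \<Rightarrow> (real \<Rightarrow> real) set \<Rightarrow> (real \<Rightarrow> real) set \<Rightarrow> bool" where
  "gen_less \<rho> X Y \<longleftrightarrow> gen_le X Y \<and> Y \<ominus>\<^bsub>gen_real \<rho>\<^esub> X \<in> Units (gen_real \<rho>)"

definition gen_pos :: "(real \<Rightarrow> real) \<Rightarrow> (real \<Rightarrow> real) set set" where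
  "gen_pos \<rho> = {X \<in> carrier (gen_real \<rho>). gen_less \<rho> \<zero>\<^bsub>gen_real \<rho>\<^esub> X}"

definition internal_set ::
    "(real \<Rightarrow> real) \<Rightarrow> (real \<Rightarrow> 'a nspace) \<Rightarrow> (real \<Rightarrow> 'a set) \<Rightarrow> (real \<Rightarrow> 'a) set set" where
  "internal_set \<rho> E A = {U \<in> carrier (gen_space \<rho> E).
     \<exists>u\<in>U. \<forall>\<^sub>F \<epsilon> in at_right 0. u \<epsilon> \<in> A \<epsilon>}"

definition linear_functional ::
    "('r, 'k) ring_scheme \<Rightarrow> ('r, 'a, 'm) module_scheme \<Rightarrow> 'a set \<Rightarrow> ('a \<Rightarrow> 'r) \<Rightarrow> bool" where
  "linear_functional R M H f \<longleftrightarrow> f \<in> H \<rightarrow> carrier R \<and>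
     (\<forall>u\<in>H. \<forall>v\<in>H. f (u \<oplus>\<^bsub>M\<^esub> v) = f u \<oplus>\<^bsub>R\<^esub> f v) \<and>
     (\<forall>a\<in>carrier R. \<forall>u\<in>H. f (a \<odot>\<^bsub>M\<^esub> u) = a \<otimes>\<^bsub>R\<^esub> f u)"

definition sublinear_functional ::
    "('r, 'k) ring_scheme \<Rightarrow> 'r set \<Rightarrow> ('r \<Rightarrow> 'r \<Rightarrow> bool) \<Rightarrow> ('r, 'a, 'm) module_scheme \<Rightarrow>
     ('a \<Rightarrow> 'r) \<Rightarrow> bool" where
  "sublinear_functional R Pos leq M p \<longleftrightarrow> p \<in> carrier M \<rightarrow> carrier R \<and>
     (\<forall>a\<in>Pos. \<forall>u\<in>carrier M. p (a \<odot>\<^bsub>M\<^esub> u) = a \<otimes>\<^bsub>R\<^esub> p u) \<and>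
     (\<forall>u\<in>carrier M. \<forall>v\<in>carrier M. leq (p (u \<oplus>\<^bsub>M\<^esub> v)) (p u \<oplus>\<^bsub>R\<^esub> p v))"

text \<open>
  \<open>D \<epsilon>\<close> is the domain of the representative \<open>Te \<epsilon>\<close>: all of \<open>E \<epsilon>\<close>, or the generator \<open>F \<epsilon>\<close> of an
  internal submodule.
\<close>

definition represents :: "(real \<Rightarrow> real) \<Rightarrow> (real \<Rightarrow> 'a nspace) \<Rightarrow> (real \<Rightarrow> 'a set) \<Rightarrow>
    (real \<Rightarrow> 'a \<Rightarrow> real) \<Rightarrow> ((real \<Rightarrow> 'a) set \<Rightarrow> (real \<Rightarrow> real) set) \<Rightarrow> bool" where
  "represents \<rho> E D Te T \<longleftrightarrow>
     (\<forall>u \<in> moderate \<rho> E \<inter> Pi idx D. (\<lambda>\<epsilon>. Te \<epsilon> (u \<epsilon>)) \<in> moderate \<rho> real_nets) \<and>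
     (\<forall>u \<in> moderate \<rho> E \<inter> Pi idx D. \<forall>v \<in> moderate \<rho> E \<inter> Pi idx D.
        (\<lambda>\<epsilon>. u \<epsilon> \<ominus>\<^bsub>E \<epsilon>\<^esub> v \<epsilon>) \<in> negligible \<rho> E \<longrightarrow>
        (\<lambda>\<epsilon>. Te \<epsilon> (u \<epsilon>) - Te \<epsilon> (v \<epsilon>)) \<in> negligible \<rho> real_nets) \<and>
     (\<forall>u \<in> moderate \<rho> E \<inter> Pi idx D.
        T (net_class \<rho> E u) = net_class \<rho> real_nets (\<lambda>\<epsilon>. Te \<epsilon> (u \<epsilon>)))"

definition has_linear_representatives :: "(real \<Rightarrow> real) \<Rightarrow> (real \<Rightarrow> 'a nspace) \<Rightarrow>
    (real \<Rightarrow> 'a set) \<Rightarrow> ((real \<Rightarrow> 'a) set \<Rightarrow> (real \<Rightarrow> real) set) \<Rightarrow> bool" where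
  "has_linear_representatives \<rho> E D T \<longleftrightarrow>
     (\<exists>Te. (\<forall>\<epsilon>\<in>idx. linear_functional real_line (E \<epsilon>) (D \<epsilon>) (Te \<epsilon>)) \<and> represents \<rho> E D Te T)"

definition has_sublinear_representatives :: "(real \<Rightarrow> real) \<Rightarrow> (real \<Rightarrow> 'a nspace) \<Rightarrow>
    ((real \<Rightarrow> 'a) set \<Rightarrow> (real \<Rightarrow> real) set) \<Rightarrow> bool" where
  "has_sublinear_representatives \<rho> E T \<longleftrightarrow>
     (\<exists>Te. (\<forall>\<epsilon>\<in>idx. sublinear_functional real_line {0<..} (\<le>) (E \<epsilon>) (Te \<epsilon>)) \<and>
        represents \<rho> E (\<lambda>\<epsilon>. carrier (E \<epsilon>)) Te T)"

end

theory Submission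
  imports Defs
begin

text \<open>
  Fix representatives \<open>pe\<close>, \<open>ge\<close> of \<open>p\<close>, \<open>g\<close>, and let \<open>d \<epsilon>\<close> be the supremum of \<open>ge \<epsilon> - pe \<epsilon>\<close> over
  the unit ball of \<open>Fe \<epsilon>\<close>. A net of unit ball vectors violating a given bound is moderate, so the
  inequality \<open>g \<le> p\<close>, applied to its class, shows that \<open>d\<close> is negligible. For small \<open>\<epsilon>\<close> the functional
  \<open>x \<mapsto> pe \<epsilon> x + d \<epsilon> * nrm (E \<epsilon>) x\<close> is sublinear and dominates \<open>ge \<epsilon>\<close> exactly, so the classical
  Hahn--Banach theorem extends \<open>ge \<epsilon>\<close> to all of \<open>E \<epsilon>\<close>. The correction is negligible on moderate nets.
\<close>

text \<open>The obstacle is that \<open>g \<le> p\<close> does not give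
  \<open>ge \<epsilon> \<le> pe \<epsilon>\<close> on \<open>Fe \<epsilon>\<close>: it gives, for
  each moderate net, a negligible error that may depend on the net. Unit balls make the error
  uniform, because every choice of vectors from them is a moderate net, and positive homogeneity
  spreads the bound to all of \<open>Fe \<epsilon>\<close>. Hence the correction is a multiple of
  the norm; a positive additive constant would destroy sublinearity. That the extension acts on
  classes comes for free: domination at a vector and at its negative bounds it from both sides. The
  classical theorem is derived from minimal sublinear functionals, so the Zorn argument only meets
  functionals on the whole space and no partial extensions are glued.\<close>

lemma real_line_simps [simp]:
  "carrier real_line = UNIV" "x \<oplus>\<^bsub>real_line\<^esub> y = x + y" "x \<otimes>\<^bsub>real_line\<^esub> y = x * y"
  "\<zero>\<^bsub>real_line\<^esub> = 0" "\<one>\<^bsub>real_line\<^esub> = 1" "x \<odot>\<^bsub>real_line\<^esub> y = x * y"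
  "nrm real_line x = \<bar>x\<bar>"
  by (simp_all add: real_line_def)

lemma cring_real_line: "cring real_line"
proof (rule cringI)
  show "abelian_group real_line"
    by (rule abelian_groupI) (auto intro: exI[of _ "- x" for x])
  show "comm_monoid real_line"
    by unfold_locales auto
qed (auto simp: algebra_simps)

lemma a_inv_real_line [simp]: "\<ominus>\<^bsub>real_line\<^esub> x = - x"
proof -
  interpret cring real_line by (rule cring_real_line)
  show ?thesis by (rule minus_equality) auto
qed

lemma a_minus_real_line [simp]: "x \<ominus>\<^bsub>real_line\<^esub> y = x - y"
  by (simp add: a_minus_def)

text \<open>Through this instance the scalars are themselves nets in normed spaces, so facts about
  classes of vector nets apply to generalized reals.\<close>

lemma normed_space_real_line: "normed_space real_line"
proof -
  interpret cring real_line by (rule cring_real_line)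
  have "Module.module real_line real_line"
    by (rule Module.moduleI) (auto simp: algebra_simps is_abelian_group cring_real_line)
  then show ?thesis
    by (intro normed_space.intro normed_space_axioms.intro) (auto simp: abs_mult)
qed

section \<open>The classical Hahn--Banach theorem\<close>

text \<open>Take the greatest lower bound over one index while the other is fixed, twice.
  Subadditivity of both kinds of pointwise infima below ends here.\<close>

lemma le_add_cINF:
  fixes f :: "'a \<Rightarrow> real" and g :: "'b \<Rightarrow> real"
  assumes "A \<noteq> {}" "B \<noteq> {}" "\<And>a b. \<lbrakk>a \<in> A; b \<in> B\<rbrakk> \<Longrightarrow> c \<le> f a + g b"
  shows "c \<le> Inf (f ` A) + Inf (g ` B)"
proof -
  have "c - Inf (f ` A) \<le> Inf (g ` B)"
  proof (rule cINF_greatest[OF assms(2)])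
    fix b assume "b \<in> B"
    then have "c - g b \<le> Inf (f ` A)"
      using assms(3) by (intro cINF_greatest[OF assms(1)]) (simp add: algebra_simps)
    then show "c - Inf (f ` A) \<le> g b" by simp
  qed
  then show ?thesis by simp
qed

text \<open>The classical theorem is purely algebraic and is kept apart from norms; the record
  scheme lets it apply to normed spaces directly.\<close>

locale real_module = Module.module real_line X for X :: "(real, 'a, 'm) module_scheme" (structure)
begin

abbreviation sublinear :: "('a \<Rightarrow> real) \<Rightarrow> bool" where
  "sublinear \<equiv> sublinear_functional real_line {0<..} (\<le>) X"

lemma smult_inverse_cancel: "\<lbrakk>a \<noteq> 0; x \<in> carrier X\<rbrakk> \<Longrightarrow> inverse a \<odot> (a \<odot> x) = x"
  using smult_assoc1[of "inverse a" a x] smult_one[of x] by (simp del: smult_one)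

lemma smult_minus_one: "x \<in> carrier X \<Longrightarrow> (-1) \<odot> x = \<ominus> x"
  using smult_l_minus[of 1 x] smult_one[of x] by (simp del: smult_one)

lemma sublinearD:
  assumes "sublinear q"
  shows "\<lbrakk>0 < a; x \<in> carrier X\<rbrakk> \<Longrightarrow> q (a \<odot> x) = a * q x"
    and "\<lbrakk>x \<in> carrier X; y \<in> carrier X\<rbrakk> \<Longrightarrow> q (x \<oplus> y) \<le> q x + q y"
  using assms by (auto simp: sublinear_functional_def)

text \<open>One inequality of homogeneity suffices: used for \<open>inverse a\<close> at the vector
  \<open>a \<odot> x\<close>, it turns into the reverse one.\<close>

lemma sublinearI:
  assumes hom: "\<And>a x. \<lbrakk>0 < a; x \<in> carrier X\<rbrakk> \<Longrightarrow> q (a \<odot> x) \<le> a * q x"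
    and add: "\<And>x y. \<lbrakk>x \<in> carrier X; y \<in> carrier X\<rbrakk> \<Longrightarrow> q (x \<oplus> y) \<le> q x + q y"
  shows "sublinear q"
proof -
  have "q (a \<odot> x) = a * q x" if a: "0 < a" and x: "x \<in> carrier X" for a x
  proof (rule antisym)
    have "q x \<le> inverse a * q (a \<odot> x)"
      using hom[of "inverse a" "a \<odot> x"] smult_inverse_cancel[of a x] a x by simp
    then show "a * q x \<le> q (a \<odot> x)"
      using a by (simp add: field_simps)
  qed (use a x hom in simp)
  then show ?thesis
    using add by (auto simp: sublinear_functional_def)
qed

text \<open>Homogeneity is only given for positive factors, so 0 cannot be inserted; the factor 2
  gives that the value at zero equals its double.\<close>

lemma sublinear_zero: "sublinear q \<Longrightarrow> q \<zero> = 0"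
  using sublinearD(1)[of q 2 \<zero>] by simp

lemma sublinear_neg_le:
  assumes "sublinear q" "x \<in> carrier X"
  shows "- q (\<ominus> x) \<le> q x"
  using sublinearD(2)[OF assms(1), of x "\<ominus> x"] sublinear_zero[OF assms(1)] assms(2)
  by (simp add: M.r_neg)

lemma sublinear_smult_nonneg:
  "\<lbrakk>sublinear q; 0 \<le> a; x \<in> carrier X\<rbrakk> \<Longrightarrow> q (a \<odot> x) = a * q x"
  using sublinearD(1)[of q a x] sublinear_zero[of q] smult_l_null[of x]
  by (cases "a = 0") auto

text \<open>\<open>r\<close> is the infimum of \<open>q (x \<oplus> v) - h v\<close> over the cone
  \<open>K\<close>; at \<open>x = \<ominus> v\<close> this forces
  \<open>r (\<ominus> v) \<le> - h v\<close>. A cone rather than a subspace is allowed because there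
  are two uses: a ray, to show that minimal functionals are additive, and the subspace
  \<open>H\<close>, to prescribe \<open>g\<close> on it.\<close>

lemma sublinear_inf_conv:
  assumes q: "sublinear q" and K: "K \<subseteq> carrier X" "\<zero> \<in> K"
    and K_add: "\<And>u v. \<lbrakk>u \<in> K; v \<in> K\<rbrakk> \<Longrightarrow> u \<oplus> v \<in> K \<and> h (u \<oplus> v) = h u + h v"
    and K_smult: "\<And>a v. \<lbrakk>0 < a; v \<in> K\<rbrakk> \<Longrightarrow> a \<odot> v \<in> K \<and> h (a \<odot> v) = a * h v"
    and dom: "\<And>v. v \<in> K \<Longrightarrow> h v \<le> q v"
  obtains r where "sublinear r" "\<And>x. x \<in> carrier X \<Longrightarrow> r x \<le> q x"
    "\<And>x v. \<lbrakk>x \<in> carrier X; v \<in> K\<rbrakk> \<Longrightarrow> r x \<le> q (x \<oplus> v) - h v"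
proof -
  define r where "r x = (INF v\<in>K. q (x \<oplus> v) - h v)" for x
  \<comment> \<open>The bound is free of \<open>v\<close>, so the infimum is finite. It combines
    \<open>h v \<le> q v\<close> with the splitting of \<open>v\<close> into
    \<open>x \<oplus> v\<close> and \<open>\<ominus> x\<close>.\<close>
  have low: "- q (\<ominus> x) \<le> q (x \<oplus> v) - h v" if "x \<in> carrier X" "v \<in> K" for x v
  proof -
    have v: "v \<in> carrier X" using that K by auto
    have "q ((x \<oplus> v) \<oplus> \<ominus> x) \<le> q (x \<oplus> v) + q (\<ominus> x)"
      using that v by (intro sublinearD(2)[OF q]) auto
    moreover have "(x \<oplus> v) \<oplus> \<ominus> x = v"
      using that v by (metis M.a_comm M.add.inv_closed M.add.inv_solve_right M.a_closed)
    ultimately show ?thesis using dom[OF that(2)] by simp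
  qed
  have r_le: "r x \<le> q (x \<oplus> v) - h v" if "x \<in> carrier X" "v \<in> K" for x v
    unfolding r_def by (rule cINF_lower[OF bdd_belowI2[of _ "- q (\<ominus> x)"]]) (use that low in auto)
  have h0: "h \<zero> = 0" using K_add[OF K(2) K(2)] by simp
  show thesis
  proof (rule that[OF _ _ r_le])
    show "r x \<le> q x" if "x \<in> carrier X" for x
      using r_le[OF that K(2)] that h0 by simp
    show "sublinear r"
    proof (rule sublinearI)
      fix a x assume a: "0 < (a::real)" and x: "x \<in> carrier X"
      \<comment> \<open>As \<open>K\<close> is a cone, the rescaled \<open>a \<odot> v\<close> is a
        competitor in the infimum at \<open>a \<odot> x\<close>.\<close>
      have "inverse a * r (a \<odot> x) \<le> r x"
        unfolding r_def[of x]
      proof (rule cINF_greatest)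
        fix v assume v: "v \<in> K"
        then have "r (a \<odot> x) \<le> q (a \<odot> x \<oplus> a \<odot> v) - h (a \<odot> v)"
          using K_smult[OF a v] x by (intro r_le) auto
        also have "a \<odot> x \<oplus> a \<odot> v = a \<odot> (x \<oplus> v)"
          using x v K by (subst smult_r_distr) auto
        also have "q (a \<odot> (x \<oplus> v)) - h (a \<odot> v) = a * (q (x \<oplus> v) - h v)"
          using K_smult[OF a v] sublinearD(1)[OF q a, of "x \<oplus> v"] x v K
          by (auto simp: algebra_simps subset_eq)
        finally show "inverse a * r (a \<odot> x) \<le> q (x \<oplus> v) - h v"
          using a by (simp add: field_simps)
      qed (use K in auto)
      then show "r (a \<odot> x) \<le> a * r x" using a by (simp add: field_simps)
    next
      fix x y assume x: "x \<in> carrier X" and y: "y \<in> carrier X"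
      show "r (x \<oplus> y) \<le> r x + r y"
        unfolding r_def[of x] r_def[of y]
      proof (rule le_add_cINF)
        fix u v assume uv: "u \<in> K" "v \<in> K"
        then have c: "u \<in> carrier X" "v \<in> carrier X" using K by auto
        have "r (x \<oplus> y) \<le> q ((x \<oplus> y) \<oplus> (u \<oplus> v)) - h (u \<oplus> v)"
          using K_add[OF uv] x y by (intro r_le) auto
        also have "(x \<oplus> y) \<oplus> (u \<oplus> v) = (x \<oplus> u) \<oplus> (y \<oplus> v)"
          using x y c by (simp add: M.a_ac)
        also have "q \<dots> \<le> q (x \<oplus> u) + q (y \<oplus> v)"
          using x y c by (intro sublinearD(2)[OF q]) auto
        finally show "r (x \<oplus> y) \<le> (q (x \<oplus> u) - h u) + (q (y \<oplus> v) - h v)"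
          using K_add[OF uv] by simp
      qed (use K in auto)
    qed
  qed
qed

text \<open>Infima of arbitrary families need not be subadditive. In a chain, the smaller of
  \<open>r\<close> and \<open>s\<close> can be used at both vectors at once.\<close>

lemma sublinear_chain_Inf:
  assumes C: "C \<noteq> {}" "\<And>r. r \<in> C \<Longrightarrow> sublinear r"
    and chain: "\<And>r s. \<lbrakk>r \<in> C; s \<in> C\<rbrakk> \<Longrightarrow> r \<le> s \<or> s \<le> r"
    and bdd: "\<And>x. x \<in> carrier X \<Longrightarrow> bdd_below ((\<lambda>r. r x) ` C)"
  shows "sublinear (\<lambda>x. INF r\<in>C. r x)"
proof (rule sublinearI)
  fix a x assume a: "0 < (a::real)" and x: "x \<in> carrier X"
  have "inverse a * (INF r\<in>C. r (a \<odot> x)) \<le> (INF r\<in>C. r x)"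
  proof (rule cINF_greatest[OF C(1)])
    fix r assume "r \<in> C"
    then have "(INF r\<in>C. r (a \<odot> x)) \<le> r (a \<odot> x)"
      using x by (intro cINF_lower[OF bdd]) auto
    also have "\<dots> = a * r x"
      using \<open>r \<in> C\<close> a x by (intro sublinearD(1)[OF C(2)])
    finally show "inverse a * (INF r\<in>C. r (a \<odot> x)) \<le> r x"
      using a by (simp add: field_simps)
  qed
  then show "(INF r\<in>C. r (a \<odot> x)) \<le> a * (INF r\<in>C. r x)"
    using a by (simp add: field_simps)
next
  fix x y assume x: "x \<in> carrier X" and y: "y \<in> carrier X"
  show "(INF r\<in>C. r (x \<oplus> y)) \<le> (INF r\<in>C. r x) + (INF r\<in>C. r y)"
  proof (rule le_add_cINF[OF C(1) C(1)])
    fix r s assume rs: "r \<in> C" "s \<in> C"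
    obtain m where m: "m \<in> C" "m \<le> r" "m \<le> s"
      using chain[OF rs] rs by blast
    have "(INF r\<in>C. r (x \<oplus> y)) \<le> m (x \<oplus> y)"
      using m x y by (intro cINF_lower[OF bdd]) auto
    also have "\<dots> \<le> m x + m y"
      using m(1) x y by (intro sublinearD(2)[OF C(2)])
    also have "\<dots> \<le> r x + s y"
      using m by (intro add_mono) (auto simp: le_fun_def)
    finally show "(INF r\<in>C. r (x \<oplus> y)) \<le> r x + s y" .
  qed
qed

lemma sublinear_cong:
  assumes "\<And>x. x \<in> carrier X \<Longrightarrow> r x = s x" "sublinear r"
  shows "sublinear s"
  using sublinearD[OF assms(2)] assms(1) by (intro sublinearI) auto

text \<open>Zorn's lemma for the reversed pointwise order; chains are bounded by their pointwise
  infimum.\<close>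

lemma minimal_sublinear_exists:
  assumes q: "sublinear q"
  obtains m where "sublinear m" "\<And>x. x \<in> carrier X \<Longrightarrow> m x \<le> q x"
    "\<And>r x. \<lbrakk>sublinear r; \<And>y. y \<in> carrier X \<Longrightarrow> r y \<le> m y; x \<in> carrier X\<rbrakk> \<Longrightarrow> r x = m x"
proof -
  define cut where "cut r x = (if x \<in> carrier X then r x else 0 :: real)" for r x
  \<comment> \<open>\<open>A\<close> requires values 0 off the carrier, since the pointwise order sees them.\<close>
  define A where "A = {r. sublinear r \<and> cut r = r \<and> (\<forall>x\<in>carrier X. r x \<le> q x)}"
  have cut_in: "cut r \<in> A" if "sublinear r" "\<And>x. x \<in> carrier X \<Longrightarrow> r x \<le> q x" for r
  proof -
    have "sublinear (cut r)"
      by (rule sublinear_cong[OF _ that(1)]) (simp add: cut_def)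
    then show ?thesis using that(2) by (auto simp: A_def cut_def)
  qed
  \<comment> \<open>A lower bound shared by all members of \<open>A\<close>, which keeps infima over
    chains finite.\<close>
  have low: "- q (\<ominus> x) \<le> r x" if "r \<in> A" "x \<in> carrier X" for r x
  proof -
    have "- q (\<ominus> x) \<le> - r (\<ominus> x)" using that by (auto simp: A_def)
    also have "\<dots> \<le> r x" using that by (intro sublinear_neg_le) (auto simp: A_def)
    finally show ?thesis .
  qed
  have "\<exists>m\<in>A. \<forall>r\<in>A. m \<ge> r \<longrightarrow> r = m"
  proof (rule predicate_Zorn)
    show "partial_order_on A (relation_of (\<ge>) A)"
      by (rule partial_order_on_relation_ofI) auto
  next
    fix C assume C: "C \<in> Chains (relation_of (\<ge>) A)"
    then have CA: "C \<subseteq> A" by (auto simp: Chains_def relation_of_def)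
    show "\<exists>u\<in>A. \<forall>r\<in>C. r \<ge> u"
    proof (cases "C = {}")
      case True
      then show ?thesis using cut_in[OF q] by auto
    next
      case False
      have bdd: "bdd_below ((\<lambda>r. r x) ` C)" if "x \<in> carrier X" for x
        using low[OF _ that] CA by (intro bdd_belowI2) auto
      let ?i = "\<lambda>x. INF r\<in>C. r x"
      have i_le: "?i x \<le> r x" if "r \<in> C" "x \<in> carrier X" for r x
        using bdd that by (intro cINF_lower) auto
      have "sublinear ?i"
      proof (rule sublinear_chain_Inf[OF False _ _ bdd])
        show "r \<le> s \<or> s \<le> r" if "r \<in> C" "s \<in> C" for r s
          using C that by (auto simp: Chains_def relation_of_def)
      qed (use CA A_def in auto)
      moreover obtain r0 where "r0 \<in> C" using False by auto
      then have "?i x \<le> q x" if "x \<in> carrier X" for x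
        using i_le[of r0 x] CA that by (force simp: A_def)
      ultimately have "cut ?i \<in> A" by (rule cut_in)
      moreover have "cut ?i \<le> r" if "r \<in> C" for r
      proof (rule le_funI)
        fix x
        have "cut r x = r x" using that CA by (auto simp: A_def)
        then show "cut ?i x \<le> r x" using i_le[OF that, of x] by (auto simp: cut_def split: if_splits)
      qed
      ultimately show ?thesis by blast
    qed
  qed
  then obtain m where m: "m \<in> A" "\<And>r. \<lbrakk>r \<in> A; r \<le> m\<rbrakk> \<Longrightarrow> r = m" by blast
  \<comment> \<open>Zorn's lemma only compares \<open>m\<close> with functionals normalised off the
    carrier; passing to \<open>cut r\<close> reaches arbitrary ones.\<close>
  have "r x = m x" if r: "sublinear r" "\<And>y. y \<in> carrier X \<Longrightarrow> r y \<le> m y" and x: "x \<in> carrier X" for r x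
  proof -
    have "cut r \<in> A"
      using r m(1) by (intro cut_in) (force simp: A_def)+
    moreover have "cut r \<le> cut m" using r(2) by (auto simp: cut_def le_fun_def)
    then have "cut r \<le> m" using m(1) by (simp add: A_def)
    ultimately have "cut r = m" by (rule m(2))
    then show ?thesis using x by (auto simp: cut_def)
  qed
  then show thesis using m(1) by (intro that[of m]) (auto simp: A_def)
qed

text \<open>
  A minimal sublinear functional equals its infimal convolution with its restriction to any ray,
  which forces additivity.
\<close>

lemma linear_minorant_exists:
  assumes q: "sublinear q"
  obtains f where "linear_functional real_line X (carrier X) f" "\<And>x. x \<in> carrier X \<Longrightarrow> f x \<le> q x"
proof -
  obtain m where m: "sublinear m" "\<And>x. x \<in> carrier X \<Longrightarrow> m x \<le> q x"
    and min: "\<And>r x. \<lbrakk>sublinear r; \<And>y. y \<in> carrier X \<Longrightarrow> r y \<le> m y; x \<in> carrier X\<rbrakk> \<Longrightarrow> r x = m x"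
    by (rule minimal_sublinear_exists[OF q]) blast
  note hom = sublinear_smult_nonneg[OF m(1)]
  have add: "m (x \<oplus> y) = m x + m y" if x: "x \<in> carrier X" and y: "y \<in> carrier X" for x y
  proof (rule antisym)
    let ?K = "(\<lambda>t. t \<odot> y) ` {0..}"
    obtain r where r: "sublinear r" "\<And>z. z \<in> carrier X \<Longrightarrow> r z \<le> m z"
      and r': "\<And>z v. \<lbrakk>z \<in> carrier X; v \<in> ?K\<rbrakk> \<Longrightarrow> r z \<le> m (z \<oplus> v) - m v"
    proof (rule sublinear_inf_conv[OF m(1), of ?K m])
      show "\<zero> \<in> ?K" using y by (intro image_eqI[of _ _ 0]) (auto simp: smult_l_null[simplified])
      show "u \<oplus> v \<in> ?K \<and> m (u \<oplus> v) = m u + m v" if "u \<in> ?K" "v \<in> ?K" for u v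
      proof -
        from that obtain s t where st: "s \<ge> 0" "t \<ge> 0" "u = s \<odot> y" "v = t \<odot> y" by auto
        have "u \<oplus> v = (s + t) \<odot> y" using smult_l_distr[of s t y] st y by simp
        then show ?thesis using st y hom[of "s + t" y] hom[of s y] hom[of t y]
          by (auto simp: algebra_simps)
      qed
      show "a \<odot> v \<in> ?K \<and> m (a \<odot> v) = a * m v" if "0 < a" "v \<in> ?K" for a v
      proof -
        from that obtain t where t: "t \<ge> 0" "v = t \<odot> y" by auto
        have "a \<odot> v = (a * t) \<odot> y" using smult_assoc1[of a t y] t y by simp
        then show ?thesis using t that y hom[of "a * t" y] hom[of t y] by auto
      qed
    qed (use y in auto)
    \<comment> \<open>The witness is \<open>v = y\<close>, the point of the ray at parameter 1.
      Minimality replaces \<open>r x\<close> by \<open>m x\<close>, which yields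
      superadditivity.\<close>
    have "y \<in> ?K" using smult_one[OF y] by (intro image_eqI[of _ _ 1]) auto
    then have "r x \<le> m (x \<oplus> y) - m y" using x by (intro r')
    then show "m x + m y \<le> m (x \<oplus> y)" using min[OF r x] by simp
  qed (use x y sublinearD(2)[OF m(1)] in simp)
  \<comment> \<open>Additivity makes \<open>m\<close> odd, and oddness carries homogeneity over to
    negative factors.\<close>
  have neg: "m (\<ominus> x) = - m x" if "x \<in> carrier X" for x
    using add[of x "\<ominus> x"] that sublinear_zero[OF m(1)] by (simp add: M.r_neg)
  have smult: "m (a \<odot> x) = a * m x" if x: "x \<in> carrier X" for a x
  proof (cases "0 \<le> a")
    case True
    then show ?thesis using hom x by simp
  next
    case False
    have "a \<odot> x = \<ominus> ((- a) \<odot> x)" using smult_l_minus[of "- a" x] x by simp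
    then show ?thesis using False x hom[of "- a" x] neg[of "(- a) \<odot> x"] by simp
  qed
  show thesis
    using add smult m(2) by (intro that[of m]) (auto simp: linear_functional_def)
qed

text \<open>Let \<open>r\<close> be the convolution of \<open>q\<close> with \<open>g\<close> over
  \<open>H\<close>. Any linear \<open>f \<le> r\<close> satisfies
  \<open>f v \<le> q \<zero> - g (\<ominus> v) = g v\<close> on \<open>H\<close>; the same at
  \<open>\<ominus> v\<close> gives equality, so a linear minorant of \<open>r\<close> is already an
  extension.\<close>

theorem Hahn_Banach:
  assumes q: "sublinear q" and H: "submodule H real_line X"
    and g: "linear_functional real_line X H g" and dom: "\<And>x. x \<in> H \<Longrightarrow> g x \<le> q x"
  obtains f where "linear_functional real_line X (carrier X) f"
    "\<And>x. x \<in> H \<Longrightarrow> f x = g x" "\<And>x. x \<in> carrier X \<Longrightarrow> f x \<le> q x"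
proof -
  note HE = submoduleE[OF H]
  have gadd: "g (u \<oplus> v) = g u + g v" if "u \<in> H" "v \<in> H" for u v
    using g that by (simp add: linear_functional_def)
  have gsmult: "g (a \<odot> u) = a * g u" if "u \<in> H" for a u
    using g that by (simp add: linear_functional_def)
  have zero: "\<zero> \<in> H"
    using subgroup.one_closed[OF submodule.axioms(1)[OF H]] by simp
  have gneg: "g (\<ominus> u) = - g u" if "u \<in> H" for u
    using gsmult[of u "-1"] that HE(1) by (auto simp: smult_minus_one)
  obtain r where r: "sublinear r" "\<And>x. x \<in> carrier X \<Longrightarrow> r x \<le> q x"
    and r': "\<And>x v. \<lbrakk>x \<in> carrier X; v \<in> H\<rbrakk> \<Longrightarrow> r x \<le> q (x \<oplus> v) - g v"
    by (rule sublinear_inf_conv[OF q HE(1) zero, of g])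
      (use dom gadd gsmult HE in auto)
  obtain f where f: "linear_functional real_line X (carrier X) f"
    "\<And>x. x \<in> carrier X \<Longrightarrow> f x \<le> r x"
    by (rule linear_minorant_exists[OF r(1)]) blast
  have fneg: "f (\<ominus> x) = - f x" if "x \<in> carrier X" for x
    using f(1) that unfolding linear_functional_def
    by (metis UNIV_I mult_minus1 real_line_simps(1,3) smult_minus_one)
  have le: "f v \<le> g v" if "v \<in> H" for v
  proof -
    have v: "v \<in> carrier X" "\<ominus> v \<in> H" using that HE by auto
    have "f v \<le> q (v \<oplus> \<ominus> v) - g (\<ominus> v)"
      using f(2)[OF v(1)] r'[OF v] by simp
    then show ?thesis using v gneg[OF that] sublinear_zero[OF q] by (simp add: M.r_neg)
  qed
  show thesis
  proof (rule that[OF f(1)])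
    show "f x = g x" if "x \<in> H" for x
      using le[OF that] le[of "\<ominus> x"] fneg[of x] gneg[OF that] HE that by force
    show "f x \<le> q x" if "x \<in> carrier X" for x
      using f(2)[OF that] r(2)[OF that] by simp
  qed
qed

end

section \<open>Norm estimates and extension with a defect\<close>

context normed_space
begin

sublocale real_module X ..

lemma nrm_zero [simp]: "nrm X \<zero> = 0"
  by (simp add: nrm_eq_0_iff)

lemma nrm_uminus: "x \<in> carrier X \<Longrightarrow> nrm X (\<ominus> x) = nrm X x"
  using nrm_smult[of x "-1"] by (simp add: smult_minus_one)

lemma nrm_diff_commute:
  assumes "x \<in> carrier X" "y \<in> carrier X"
  shows "nrm X (x \<ominus> y) = nrm X (y \<ominus> x)"
proof -
  have "y \<ominus> x = \<ominus> (x \<ominus> y)"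
    using assms by (simp add: a_minus_def M.minus_add M.a_comm)
  then show ?thesis using assms nrm_uminus[of "x \<ominus> y"] by simp
qed

lemma nrm_diff_triangle:
  assumes "x \<in> carrier X" "y \<in> carrier X" "z \<in> carrier X"
  shows "nrm X (x \<ominus> z) \<le> nrm X (x \<ominus> y) + nrm X (y \<ominus> z)"
proof -
  have "(x \<ominus> y) \<oplus> (y \<ominus> z) = x \<ominus> z"
    using assms by (simp add: a_minus_def M.a_assoc M.r_neg1 M.r_neg2)
  then show ?thesis using assms nrm_triangle[of "x \<ominus> y" "y \<ominus> z"] by simp
qed

lemma nrm_diff_add:
  assumes "x \<in> carrier X" "y \<in> carrier X" "x' \<in> carrier X" "y' \<in> carrier X"
  shows "nrm X ((x \<oplus> y) \<ominus> (x' \<oplus> y')) \<le> nrm X (x \<ominus> x') + nrm X (y \<ominus> y')"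
proof -
  have "(x \<oplus> y) \<ominus> (x' \<oplus> y') = (x \<ominus> x') \<oplus> (y \<ominus> y')"
    using assms by (simp add: a_minus_def M.minus_add M.a_ac)
  then show ?thesis using assms nrm_triangle[of "x \<ominus> x'" "y \<ominus> y'"] by simp
qed

text \<open>Insert \<open>a' \<odot> x\<close> in between. For equivalent nets each summand is then
  a moderate factor times a negligible one, which makes scalar multiplication of classes well
  defined.\<close>

lemma nrm_diff_smult:
  assumes "x \<in> carrier X" "x' \<in> carrier X"
  shows "nrm X ((a \<odot> x) \<ominus> (a' \<odot> x')) \<le> \<bar>a - a'\<bar> * nrm X x + \<bar>a'\<bar> * nrm X (x \<ominus> x')"
proof -
  have "a' \<odot> (x \<ominus> x') = a' \<odot> x \<ominus> a' \<odot> x'"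
    using assms by (simp add: a_minus_def smult_r_distr smult_r_minus)
  moreover have "(a - a') \<odot> x = a \<odot> x \<ominus> a' \<odot> x"
    using assms smult_l_distr[of a "- a'" x] smult_l_minus[of a' x] by (simp add: a_minus_def)
  ultimately show ?thesis
    using nrm_diff_triangle[of "a \<odot> x" "a' \<odot> x" "a' \<odot> x'"] assms
      nrm_smult[of x "a - a'"] nrm_smult[of "x \<ominus> x'" a'] by simp
qed

text \<open>Normalising a nonzero vector turns the defect \<open>d\<close> on the unit ball into
  \<open>d * nrm X x\<close> on all of \<open>H\<close>. Because \<open>d\<close> is nonnegative,
  adding this term to \<open>q\<close> keeps it sublinear, and the exact theorem applies to the
  sum.\<close>

lemma Hahn_Banach_defect:
  assumes q: "sublinear q" and H: "submodule H real_line X"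
    and g: "linear_functional real_line X H g" and d: "0 \<le> d"
    and defect: "\<And>x. \<lbrakk>x \<in> H; nrm X x \<le> 1\<rbrakk> \<Longrightarrow> g x - q x \<le> d"
  obtains f where "linear_functional real_line X (carrier X) f"
    "\<And>x. x \<in> H \<Longrightarrow> f x = g x" "\<And>x. x \<in> carrier X \<Longrightarrow> f x \<le> q x + d * nrm X x"
proof -
  note HE = submoduleE[OF H]
  have sub: "sublinear (\<lambda>x. q x + d * nrm X x)"
  proof (rule sublinearI)
    fix x y assume "x \<in> carrier X" "y \<in> carrier X"
    then show "q (x \<oplus> y) + d * nrm X (x \<oplus> y) \<le> q x + d * nrm X x + (q y + d * nrm X y)"
      using sublinearD(2)[OF q, of x y] mult_left_mono[OF nrm_triangle[of x y] d]
      by (simp add: algebra_simps)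
  qed (use sublinearD(1)[OF q] nrm_smult in \<open>simp add: algebra_simps\<close>)
  have dom: "g x \<le> q x + d * nrm X x" if x: "x \<in> H" for x
  proof (cases "nrm X x = 0")
    case True
    have "g (0 \<odot> x) = 0 * g x" using g x unfolding linear_functional_def by auto
    moreover have "x = \<zero>" using True HE(1) x nrm_eq_0_iff by auto
    ultimately have "g x = 0" by simp
    then show ?thesis using \<open>x = \<zero>\<close> sublinear_zero[OF q] by simp
  next
    case False
    have c: "x \<in> carrier X" using HE(1) x by auto
    define a where "a = inverse (nrm X x)"
    have a: "a > 0" using False nrm_nonneg[OF c] by (simp add: a_def)
    have "g (a \<odot> x) - q (a \<odot> x) \<le> d"
      using HE(4)[of a x] x nrm_smult[OF c, of a] False nrm_nonneg[OF c]
      by (intro defect) (auto simp: a_def)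
    moreover have "g (a \<odot> x) = a * g x" using g x by (simp add: linear_functional_def)
    ultimately have "a * (g x - q x) \<le> d"
      using sublinearD(1)[OF q a c] by (simp add: algebra_simps)
    then show ?thesis
      using a False nrm_nonneg[OF c] by (simp add: a_def field_simps)
  qed
  show thesis
    by (rule Hahn_Banach[OF sub H g dom]) (use that in blast)+
qed

end

section \<open>Nets and their classes\<close>

lemma eventually_idx: "\<forall>\<^sub>F \<epsilon> in at_right (0::real). \<epsilon> \<in> idx"
  unfolding eventually_at_right_field by (intro exI[of _ 1]) auto

section \<open>Moderate and negligible real nets\<close>

locale gauge =
  fixes \<rho> :: "real \<Rightarrow> real"
  assumes range: "\<rho> \<in> idx \<rightarrow> idx"
    and lim: "(\<rho> \<longlongrightarrow> 0) (at_right 0)"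
begin

abbreviation "modR \<equiv> moderate \<rho> real_nets"
abbreviation "negR \<equiv> negligible \<rho> real_nets"

lemma eventually_gauge: "\<forall>\<^sub>F \<epsilon> in at_right 0. 0 < \<rho> \<epsilon> \<and> \<rho> \<epsilon> \<le> 1"
  using eventually_idx by eventually_elim (use range in auto)

text \<open>Since the gauge is at most 1, larger exponents give weaker bounds; two moderate nets can
  thus be compared with a common power.\<close>

lemma inverse_power_bigo:
  "m \<le> n \<Longrightarrow> (\<lambda>\<epsilon>. inverse (\<rho> \<epsilon> ^ m)) \<in> O[at_right 0](\<lambda>\<epsilon>. inverse (\<rho> \<epsilon> ^ n))"
  by (rule bigoI[of _ 1], rule eventually_mono[OF eventually_gauge])
    (auto intro!: le_imp_inverse_le power_decreasing)

lemma moderate_real_iff: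
  "x \<in> modR \<longleftrightarrow> (\<exists>N. x \<in> O[at_right 0](\<lambda>\<epsilon>. inverse (\<rho> \<epsilon> ^ N)))"
  by (simp add: moderate_def power_int_minus)

lemma negligible_real_iff: "x \<in> negR \<longleftrightarrow> (\<forall>N. x \<in> O[at_right 0](\<lambda>\<epsilon>. \<rho> \<epsilon> ^ N))"
  by (simp add: negligible_def)

lemma moderate_real_mono:
  assumes "y \<in> modR" "\<forall>\<^sub>F \<epsilon> in at_right 0. \<bar>x \<epsilon>\<bar> \<le> \<bar>y \<epsilon>\<bar>"
  shows "x \<in> modR"
proof -
  have "x \<in> O[at_right 0](y)" using assms(2) by (intro bigoI[of _ 1]) simp
  then show ?thesis
    using assms(1) landau_o.big_trans unfolding moderate_real_iff by blast
qed

lemma negligible_real_mono: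
  assumes "y \<in> negR" "\<forall>\<^sub>F \<epsilon> in at_right 0. \<bar>x \<epsilon>\<bar> \<le> \<bar>y \<epsilon>\<bar>"
  shows "x \<in> negR"
proof -
  have "x \<in> O[at_right 0](y)" using assms(2) by (intro bigoI[of _ 1]) simp
  then show ?thesis
    using assms(1) landau_o.big_trans unfolding negligible_real_iff by blast
qed

lemma moderate_real_add:
  assumes "x \<in> modR" "y \<in> modR" shows "(\<lambda>\<epsilon>. x \<epsilon> + y \<epsilon>) \<in> modR"
proof -
  obtain m n where "x \<in> O[at_right 0](\<lambda>\<epsilon>. inverse (\<rho> \<epsilon> ^ m))"
    "y \<in> O[at_right 0](\<lambda>\<epsilon>. inverse (\<rho> \<epsilon> ^ n))"
    using assms by (auto simp: moderate_real_iff)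
  then have "x \<in> O[at_right 0](\<lambda>\<epsilon>. inverse (\<rho> \<epsilon> ^ (m + n)))"
    "y \<in> O[at_right 0](\<lambda>\<epsilon>. inverse (\<rho> \<epsilon> ^ (m + n)))"
    using inverse_power_bigo[of m "m + n"] inverse_power_bigo[of n "m + n"]
      landau_o.big_trans by auto
  then show ?thesis unfolding moderate_real_iff by (blast intro: sum_in_bigo)
qed

lemma moderate_real_mult:
  assumes "x \<in> modR" "y \<in> modR" shows "(\<lambda>\<epsilon>. x \<epsilon> * y \<epsilon>) \<in> modR"
proof -
  obtain m n where "x \<in> O[at_right 0](\<lambda>\<epsilon>. inverse (\<rho> \<epsilon> ^ m))"
    "y \<in> O[at_right 0](\<lambda>\<epsilon>. inverse (\<rho> \<epsilon> ^ n))"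
    using assms by (auto simp: moderate_real_iff)
  then have "(\<lambda>\<epsilon>. x \<epsilon> * y \<epsilon>) \<in> O[at_right 0](\<lambda>\<epsilon>. inverse (\<rho> \<epsilon> ^ (m + n)))"
    using landau_o.big.mult by (force simp: power_add inverse_mult_distrib)
  then show ?thesis unfolding moderate_real_iff by blast
qed

lemma negligible_real_add: "\<lbrakk>x \<in> negR; y \<in> negR\<rbrakk> \<Longrightarrow> (\<lambda>\<epsilon>. x \<epsilon> + y \<epsilon>) \<in> negR"
  unfolding negligible_real_iff by (auto intro: sum_in_bigo)

lemma negligible_real_mult:
  assumes "x \<in> modR" "y \<in> negR" shows "(\<lambda>\<epsilon>. x \<epsilon> * y \<epsilon>) \<in> negR"
  unfolding negligible_real_iff
proof
  fix n
  obtain m where "x \<in> O[at_right 0](\<lambda>\<epsilon>. inverse (\<rho> \<epsilon> ^ m))"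
    using assms by (auto simp: moderate_real_iff)
  \<comment> \<open>The order \<open>m + n\<close> leaves \<open>n\<close> after \<open>m\<close>
    powers are spent on the growth of \<open>x\<close>.\<close>
  moreover have "y \<in> O[at_right 0](\<lambda>\<epsilon>. \<rho> \<epsilon> ^ (m + n))"
    using assms by (auto simp: negligible_real_iff)
  ultimately have "(\<lambda>\<epsilon>. x \<epsilon> * y \<epsilon>) \<in> O[at_right 0](\<lambda>\<epsilon>. inverse (\<rho> \<epsilon> ^ m) * \<rho> \<epsilon> ^ (m + n))"
    by (rule landau_o.big.mult)
  moreover have "(\<lambda>\<epsilon>. inverse (\<rho> \<epsilon> ^ m) * \<rho> \<epsilon> ^ (m + n)) \<in> O[at_right 0](\<lambda>\<epsilon>. \<rho> \<epsilon> ^ n)"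
    by (rule bigoI[of _ 1], rule eventually_mono[OF eventually_gauge]) (auto simp: power_add)
  ultimately show "(\<lambda>\<epsilon>. x \<epsilon> * y \<epsilon>) \<in> O[at_right 0](\<lambda>\<epsilon>. \<rho> \<epsilon> ^ n)"
    by (rule landau_o.big_trans)
qed

lemma moderate_real_one: "(\<lambda>_. 1) \<in> modR"
  unfolding moderate_real_iff by (intro exI[of _ 0]) simp

lemma negligible_real_imp_moderate: "x \<in> negR \<Longrightarrow> x \<in> modR"
  unfolding moderate_real_iff negligible_real_iff by (intro exI[of _ 0]) (auto dest: spec[of _ 0])

lemma negligible_real_zero: "\<forall>\<^sub>F \<epsilon> in at_right 0. x \<epsilon> = 0 \<Longrightarrow> x \<in> negR"
  by (rule negligible_real_mono[of "\<lambda>_. 0"]) (auto simp: negligible_real_iff elim: eventually_mono)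

lemma negligible_real_abs: "x \<in> negR \<Longrightarrow> (\<lambda>\<epsilon>. \<bar>x \<epsilon>\<bar>) \<in> negR"
  by (rule negligible_real_mono) auto

lemma moderate_real_abs: "x \<in> modR \<Longrightarrow> (\<lambda>\<epsilon>. \<bar>x \<epsilon>\<bar>) \<in> modR"
  by (rule moderate_real_mono) auto

text \<open>The constant hidden in \<open>O\<close> is absorbed by one spare power, because the
  gauge tends to 0. In this constant-free form a violation at a single \<epsilon> makes sense, as
  needed for choosing violating vectors.\<close>

lemma negligible_real_iff_eventually:
  "x \<in> negR \<longleftrightarrow> (\<forall>N. \<forall>\<^sub>F \<epsilon> in at_right 0. \<bar>x \<epsilon>\<bar> \<le> \<rho> \<epsilon> ^ N)"
proof
  assume x: "x \<in> negR"
  show "\<forall>N. \<forall>\<^sub>F \<epsilon> in at_right 0. \<bar>x \<epsilon>\<bar> \<le> \<rho> \<epsilon> ^ N"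
  proof
    fix N
    obtain c where c: "c > 0" "\<forall>\<^sub>F \<epsilon> in at_right 0. norm (x \<epsilon>) \<le> c * norm (\<rho> \<epsilon> ^ Suc N)"
      using x[unfolded negligible_real_iff, rule_format, of "Suc N"] by (rule landau_o.bigE)
    have "\<forall>\<^sub>F \<epsilon> in at_right 0. \<rho> \<epsilon> < inverse c"
      using c(1) by (intro order_tendstoD[OF lim]) simp
    with c(2) eventually_gauge show "\<forall>\<^sub>F \<epsilon> in at_right 0. \<bar>x \<epsilon>\<bar> \<le> \<rho> \<epsilon> ^ N"
    proof eventually_elim
      case (elim \<epsilon>)
      then have "c * \<rho> \<epsilon> \<le> 1" using c(1) by (simp add: field_simps)
      then have "(c * \<rho> \<epsilon>) * \<rho> \<epsilon> ^ N \<le> 1 * \<rho> \<epsilon> ^ N" using elim by (intro mult_right_mono) auto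
      moreover have "\<bar>x \<epsilon>\<bar> \<le> (c * \<rho> \<epsilon>) * \<rho> \<epsilon> ^ N"
        using elim by (simp add: abs_mult mult.assoc)
      ultimately show ?case by linarith
    qed
  qed
next
  assume *: "\<forall>N. \<forall>\<^sub>F \<epsilon> in at_right 0. \<bar>x \<epsilon>\<bar> \<le> \<rho> \<epsilon> ^ N"
  show "x \<in> negR"
    unfolding negligible_real_iff
  proof
    fix N
    have "\<forall>\<^sub>F \<epsilon> in at_right 0. norm (x \<epsilon>) \<le> 1 * norm (\<rho> \<epsilon> ^ N)"
      using *[rule_format, of N] by eventually_elim auto
    then show "x \<in> O[at_right 0](\<lambda>\<epsilon>. \<rho> \<epsilon> ^ N)" by (rule bigoI)
  qed
qed

end

section \<open>Nets in a family of normed spaces and their classes\<close>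

locale normed_family = gauge \<rho> for \<rho> +
  fixes E :: "real \<Rightarrow> 'a nspace"
  assumes space: "\<epsilon> \<in> idx \<Longrightarrow> normed_space (E \<epsilon>)"
begin

abbreviation "modE \<equiv> moderate \<rho> E"
abbreviation "negE \<equiv> negligible \<rho> E"
abbreviation "cls \<equiv> net_class \<rho> E"
abbreviation "clsR \<equiv> net_class \<rho> real_nets"

lemma real_nets: "normed_family \<rho> real_nets"
  by (intro normed_family.intro gauge_axioms normed_family_axioms.intro normed_space_real_line)

lemma closed:
  assumes "\<epsilon> \<in> idx"
  shows "\<zero>\<^bsub>E \<epsilon>\<^esub> \<in> carrier (E \<epsilon>)"
    and "\<lbrakk>x \<in> carrier (E \<epsilon>); y \<in> carrier (E \<epsilon>)\<rbrakk> \<Longrightarrow> x \<oplus>\<^bsub>E \<epsilon>\<^esub> y \<in> carrier (E \<epsilon>)"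
    and "\<lbrakk>x \<in> carrier (E \<epsilon>); y \<in> carrier (E \<epsilon>)\<rbrakk> \<Longrightarrow> x \<ominus>\<^bsub>E \<epsilon>\<^esub> y \<in> carrier (E \<epsilon>)"
    and "x \<in> carrier (E \<epsilon>) \<Longrightarrow> \<ominus>\<^bsub>E \<epsilon>\<^esub> x \<in> carrier (E \<epsilon>)"
    and "x \<in> carrier (E \<epsilon>) \<Longrightarrow> a \<odot>\<^bsub>E \<epsilon>\<^esub> x \<in> carrier (E \<epsilon>)"
proof -
  interpret normed_space "E \<epsilon>" by (rule space[OF assms])
  show "\<zero>\<^bsub>E \<epsilon>\<^esub> \<in> carrier (E \<epsilon>)"
    "\<lbrakk>x \<in> carrier (E \<epsilon>); y \<in> carrier (E \<epsilon>)\<rbrakk> \<Longrightarrow> x \<oplus>\<^bsub>E \<epsilon>\<^esub> y \<in> carrier (E \<epsilon>)"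
    "\<lbrakk>x \<in> carrier (E \<epsilon>); y \<in> carrier (E \<epsilon>)\<rbrakk> \<Longrightarrow> x \<ominus>\<^bsub>E \<epsilon>\<^esub> y \<in> carrier (E \<epsilon>)"
    "x \<in> carrier (E \<epsilon>) \<Longrightarrow> \<ominus>\<^bsub>E \<epsilon>\<^esub> x \<in> carrier (E \<epsilon>)"
    "x \<in> carrier (E \<epsilon>) \<Longrightarrow> a \<odot>\<^bsub>E \<epsilon>\<^esub> x \<in> carrier (E \<epsilon>)"
    by auto
qed

lemma moderate_iff:
  "u \<in> modE \<longleftrightarrow> u \<in> (\<Pi> \<epsilon>\<in>idx. carrier (E \<epsilon>)) \<and> (\<lambda>\<epsilon>. nrm (E \<epsilon>) (u \<epsilon>)) \<in> modR"
  by (simp add: moderate_def)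

lemma negligible_iff:
  "u \<in> negE \<longleftrightarrow> u \<in> (\<Pi> \<epsilon>\<in>idx. carrier (E \<epsilon>)) \<and> (\<lambda>\<epsilon>. nrm (E \<epsilon>) (u \<epsilon>)) \<in> negR"
  by (simp add: negligible_def)

lemma moderate_mono:
  assumes "u \<in> (\<Pi> \<epsilon>\<in>idx. carrier (E \<epsilon>))" "x \<in> modR"
    "\<And>\<epsilon>. \<epsilon> \<in> idx \<Longrightarrow> nrm (E \<epsilon>) (u \<epsilon>) \<le> x \<epsilon>"
  shows "u \<in> modE"
proof -
  have "\<forall>\<^sub>F \<epsilon> in at_right 0. \<bar>nrm (E \<epsilon>) (u \<epsilon>)\<bar> \<le> \<bar>x \<epsilon>\<bar>"
    using eventually_idx
  proof eventually_elim
    case (elim \<epsilon>)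
    have "u \<epsilon> \<in> carrier (E \<epsilon>)" using assms(1) elim by blast
    then show ?case
      using normed_space.nrm_nonneg[OF space[OF elim], of "u \<epsilon>"] assms(3)[OF elim] by simp
  qed
  then show ?thesis
    using assms moderate_real_mono by (auto simp: moderate_iff)
qed

lemma negligible_mono:
  assumes "u \<in> (\<Pi> \<epsilon>\<in>idx. carrier (E \<epsilon>))" "x \<in> negR"
    "\<forall>\<^sub>F \<epsilon> in at_right 0. nrm (E \<epsilon>) (u \<epsilon>) \<le> x \<epsilon>"
  shows "u \<in> negE"
proof -
  have "\<forall>\<^sub>F \<epsilon> in at_right 0. \<bar>nrm (E \<epsilon>) (u \<epsilon>)\<bar> \<le> \<bar>x \<epsilon>\<bar>"
    using eventually_idx assms(3)
  proof eventually_elim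
    case (elim \<epsilon>)
    have "u \<epsilon> \<in> carrier (E \<epsilon>)" using assms(1) elim by blast
    then show ?case
      using normed_space.nrm_nonneg[OF space[OF elim(1)], of "u \<epsilon>"] elim by simp
  qed
  then show ?thesis
    using assms negligible_real_mono by (auto simp: negligible_iff)
qed

lemma moderate_carrier: "\<lbrakk>u \<in> modE; \<epsilon> \<in> idx\<rbrakk> \<Longrightarrow> u \<epsilon> \<in> carrier (E \<epsilon>)"
  by (auto simp: moderate_iff)

lemma negligible_carrier: "\<lbrakk>u \<in> negE; \<epsilon> \<in> idx\<rbrakk> \<Longrightarrow> u \<epsilon> \<in> carrier (E \<epsilon>)"
  by (auto simp: negligible_iff)

lemma moderate_nrm: "u \<in> modE \<Longrightarrow> (\<lambda>\<epsilon>. nrm (E \<epsilon>) (u \<epsilon>)) \<in> modR"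
  by (simp add: moderate_iff)

lemma negligible_nrm: "u \<in> negE \<Longrightarrow> (\<lambda>\<epsilon>. nrm (E \<epsilon>) (u \<epsilon>)) \<in> negR"
  by (simp add: negligible_iff)

lemma negligible_imp_moderate: "u \<in> negE \<Longrightarrow> u \<in> modE"
  using negligible_real_imp_moderate by (auto simp: moderate_iff negligible_iff)

lemma moderate_zero: "(\<lambda>\<epsilon>. \<zero>\<^bsub>E \<epsilon>\<^esub>) \<in> modE"
  by (rule moderate_mono[OF _ moderate_real_one])
    (auto intro: closed simp: normed_space.nrm_zero[OF space])

lemma moderate_add: "\<lbrakk>u \<in> modE; v \<in> modE\<rbrakk> \<Longrightarrow> (\<lambda>\<epsilon>. u \<epsilon> \<oplus>\<^bsub>E \<epsilon>\<^esub> v \<epsilon>) \<in> modE"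
  by (rule moderate_mono[OF _ moderate_real_add[OF moderate_nrm[of u] moderate_nrm[of v]]])
    (auto intro!: closed normed_space.nrm_triangle space dest: moderate_carrier)

lemma moderate_uminus: "u \<in> modE \<Longrightarrow> (\<lambda>\<epsilon>. \<ominus>\<^bsub>E \<epsilon>\<^esub> u \<epsilon>) \<in> modE"
  by (rule moderate_mono[OF _ moderate_nrm])
    (auto intro!: closed eq_refl normed_space.nrm_uminus space dest: moderate_carrier)

lemma moderate_smult: "\<lbrakk>a \<in> modR; u \<in> modE\<rbrakk> \<Longrightarrow> (\<lambda>\<epsilon>. a \<epsilon> \<odot>\<^bsub>E \<epsilon>\<^esub> u \<epsilon>) \<in> modE"
  by (rule moderate_mono[OF _ moderate_real_mult[OF moderate_real_abs moderate_nrm]])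
    (auto intro!: closed eq_refl normed_space.nrm_smult space dest: moderate_carrier)

lemma negligible_uminus: "u \<in> negE \<Longrightarrow> (\<lambda>\<epsilon>. \<ominus>\<^bsub>E \<epsilon>\<^esub> u \<epsilon>) \<in> negE"
  by (rule negligible_mono[OF _ negligible_nrm])
    (auto intro!: closed eq_refl normed_space.nrm_uminus space eventually_mono[OF eventually_idx]
      dest: negligible_carrier)

text \<open>Compatibility of the operations with equivalence thereby reduces to one norm estimate at
  each \<epsilon>.\<close>

lemma net_relI:
  assumes "u \<in> modE" "v \<in> modE" "x \<in> negR"
    "\<And>\<epsilon>. \<epsilon> \<in> idx \<Longrightarrow> nrm (E \<epsilon>) (u \<epsilon> \<ominus>\<^bsub>E \<epsilon>\<^esub> v \<epsilon>) \<le> x \<epsilon>"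
  shows "(u, v) \<in> net_rel \<rho> E"
proof -
  have "(\<lambda>\<epsilon>. u \<epsilon> \<ominus>\<^bsub>E \<epsilon>\<^esub> v \<epsilon>) \<in> negE"
    by (rule negligible_mono[OF _ assms(3)])
      (use assms in \<open>auto intro!: closed eventually_mono[OF eventually_idx] dest: moderate_carrier\<close>)
  then show ?thesis using assms by (simp add: net_rel_def)
qed

lemma net_relD:
  assumes "(u, v) \<in> net_rel \<rho> E"
  shows "u \<in> modE" "v \<in> modE" "(\<lambda>\<epsilon>. nrm (E \<epsilon>) (u \<epsilon> \<ominus>\<^bsub>E \<epsilon>\<^esub> v \<epsilon>)) \<in> negR"
  using assms by (auto simp: net_rel_def negligible_iff)

text \<open>Classes only see small \<epsilon>. This permits moving a representative into a generator
  and ignoring values outside \<open>idx\<close>.\<close>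

lemma net_rel_eventually_eq:
  assumes "u \<in> modE" "v \<in> modE" "\<forall>\<^sub>F \<epsilon> in at_right 0. u \<epsilon> = v \<epsilon>"
  shows "(u, v) \<in> net_rel \<rho> E"
proof (rule net_relI[OF assms(1,2) _ order_refl], rule negligible_real_zero)
  show "\<forall>\<^sub>F \<epsilon> in at_right 0. nrm (E \<epsilon>) (u \<epsilon> \<ominus>\<^bsub>E \<epsilon>\<^esub> v \<epsilon>) = 0"
    using assms(3) eventually_idx
  proof eventually_elim
    case (elim \<epsilon>)
    interpret normed_space "E \<epsilon>" by (rule space[OF elim(2)])
    show ?case
      using elim moderate_carrier[OF assms(2)] by (simp add: a_minus_def M.r_neg)
  qed
qed

lemma equiv_net_rel: "equiv modE (net_rel \<rho> E)"
proof (rule equivI)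
  show "net_rel \<rho> E \<subseteq> modE \<times> modE" by (auto simp: net_rel_def)
  show "refl_on modE (net_rel \<rho> E)"
    by (rule refl_onI) (auto intro: net_rel_eventually_eq)
  show "sym (net_rel \<rho> E)"
  proof (rule symI)
    fix u v assume "(u, v) \<in> net_rel \<rho> E"
    note * = net_relD[OF this]
    show "(v, u) \<in> net_rel \<rho> E"
      by (rule net_relI[OF *(2,1,3)])
        (auto intro!: eq_refl normed_space.nrm_diff_commute space moderate_carrier *)
  qed
  show "trans (net_rel \<rho> E)"
  proof (rule transI)
    fix u v w assume "(u, v) \<in> net_rel \<rho> E" "(v, w) \<in> net_rel \<rho> E"
    note * = net_relD[OF this(1)] net_relD[OF this(2)]
    show "(u, w) \<in> net_rel \<rho> E"
      by (rule net_relI[OF *(1,5) negligible_real_add[OF *(3,6)]])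
        (auto intro!: normed_space.nrm_diff_triangle space moderate_carrier *)
  qed
qed

lemma mem_net_class: "v \<in> cls u \<longleftrightarrow> (u, v) \<in> net_rel \<rho> E"
  by (simp add: net_class_def)

lemma net_class_eqI: "(u, v) \<in> net_rel \<rho> E \<Longrightarrow> cls u = cls v"
  unfolding net_class_def by (rule equiv_class_eq[OF equiv_net_rel])

lemma net_class_self: "u \<in> modE \<Longrightarrow> u \<in> cls u"
  unfolding net_class_def by (rule equiv_class_self[OF equiv_net_rel])

lemma carrier_gen_space: "carrier (gen_space \<rho> E) = cls ` modE"
  by (auto simp: gen_space_def quotient_def net_class_def)

lemma Union_net_class:
  assumes "u \<in> modE" "\<And>v. (u, v) \<in> net_rel \<rho> E \<Longrightarrow> h v = h u"
  shows "(\<Union>v\<in>cls u. h v) = h u"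
proof -
  have "(\<Union>v\<in>cls u. h v) = (\<Union>v\<in>cls u. h u)"
    by (intro SUP_cong refl assms(2)) (simp add: mem_net_class)
  then show ?thesis using net_class_self[OF assms(1)] by auto
qed

lemma add_net_class:
  assumes "u \<in> modE" "v \<in> modE"
  shows "cls u \<oplus>\<^bsub>gen_space \<rho> E\<^esub> cls v = cls (\<lambda>\<epsilon>. u \<epsilon> \<oplus>\<^bsub>E \<epsilon>\<^esub> v \<epsilon>)"
proof -
  have *: "cls (\<lambda>\<epsilon>. u' \<epsilon> \<oplus>\<^bsub>E \<epsilon>\<^esub> v' \<epsilon>) = cls (\<lambda>\<epsilon>. u \<epsilon> \<oplus>\<^bsub>E \<epsilon>\<^esub> v \<epsilon>)"
    if "u' \<in> cls u" "v' \<in> cls v" for u' v'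
  proof -
    note u = net_relD[OF that(1)[unfolded mem_net_class]]
    note v = net_relD[OF that(2)[unfolded mem_net_class]]
    show ?thesis
      by (rule sym, rule net_class_eqI,
          rule net_relI[OF moderate_add[OF u(1) v(1)] moderate_add[OF u(2) v(2)]
            negligible_real_add[OF u(3) v(3)]])
        (intro normed_space.nrm_diff_add space moderate_carrier u v)
  qed
  have "cls u \<oplus>\<^bsub>gen_space \<rho> E\<^esub> cls v = (\<Union>u'\<in>cls u. \<Union>v'\<in>cls v. cls (\<lambda>\<epsilon>. u' \<epsilon> \<oplus>\<^bsub>E \<epsilon>\<^esub> v' \<epsilon>))"
    by (simp add: gen_space_def)
  also have "\<dots> = (\<Union>u'\<in>cls u. \<Union>v'\<in>cls v. cls (\<lambda>\<epsilon>. u \<epsilon> \<oplus>\<^bsub>E \<epsilon>\<^esub> v \<epsilon>))"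
    by (intro SUP_cong refl *)
  also have "\<dots> = cls (\<lambda>\<epsilon>. u \<epsilon> \<oplus>\<^bsub>E \<epsilon>\<^esub> v \<epsilon>)"
    using net_class_self[OF assms(1)] net_class_self[OF assms(2)] by auto
  finally show ?thesis .
qed

lemma smult_net_class:
  assumes "a \<in> modR" "u \<in> modE"
  shows "clsR a \<odot>\<^bsub>gen_space \<rho> E\<^esub> cls u = cls (\<lambda>\<epsilon>. a \<epsilon> \<odot>\<^bsub>E \<epsilon>\<^esub> u \<epsilon>)"
proof -
  interpret R: normed_family \<rho> real_nets by (rule real_nets)
  have *: "cls (\<lambda>\<epsilon>. a' \<epsilon> \<odot>\<^bsub>E \<epsilon>\<^esub> u' \<epsilon>) = cls (\<lambda>\<epsilon>. a \<epsilon> \<odot>\<^bsub>E \<epsilon>\<^esub> u \<epsilon>)"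
    if "a' \<in> clsR a" "u' \<in> cls u" for a' u'
  proof -
    note a = R.net_relD[OF that(1)[unfolded R.mem_net_class]]
    note u = net_relD[OF that(2)[unfolded mem_net_class]]
    \<comment> \<open>In each product the moderate factor stands first and the negligible one
      second, as \<open>negligible_real_mult\<close> expects.\<close>
    have neg: "(\<lambda>\<epsilon>. nrm (E \<epsilon>) (u \<epsilon>) * \<bar>a \<epsilon> - a' \<epsilon>\<bar>
        + \<bar>a' \<epsilon>\<bar> * nrm (E \<epsilon>) (u \<epsilon> \<ominus>\<^bsub>E \<epsilon>\<^esub> u' \<epsilon>)) \<in> negR"
      using a u by (intro negligible_real_add negligible_real_mult moderate_nrm moderate_real_abs) auto
    have le: "nrm (E \<epsilon>) (a \<epsilon> \<odot>\<^bsub>E \<epsilon>\<^esub> u \<epsilon> \<ominus>\<^bsub>E \<epsilon>\<^esub> a' \<epsilon> \<odot>\<^bsub>E \<epsilon>\<^esub> u' \<epsilon>)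
      \<le> nrm (E \<epsilon>) (u \<epsilon>) * \<bar>a \<epsilon> - a' \<epsilon>\<bar> + \<bar>a' \<epsilon>\<bar> * nrm (E \<epsilon>) (u \<epsilon> \<ominus>\<^bsub>E \<epsilon>\<^esub> u' \<epsilon>)"
      if "\<epsilon> \<in> idx" for \<epsilon>
      using normed_space.nrm_diff_smult[OF space[OF that], of "u \<epsilon>" "u' \<epsilon>" "a \<epsilon>" "a' \<epsilon>"]
        u that moderate_carrier by (simp add: mult.commute)
    show ?thesis
      by (rule sym, rule net_class_eqI,
          rule net_relI[OF moderate_smult[OF a(1) u(1)] moderate_smult[OF a(2) u(2)] neg le])
  qed
  have "clsR a \<odot>\<^bsub>gen_space \<rho> E\<^esub> cls u = (\<Union>a'\<in>clsR a. \<Union>u'\<in>cls u. cls (\<lambda>\<epsilon>. a' \<epsilon> \<odot>\<^bsub>E \<epsilon>\<^esub> u' \<epsilon>))"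
    by (simp add: gen_space_def)
  also have "\<dots> = (\<Union>a'\<in>clsR a. \<Union>u'\<in>cls u. cls (\<lambda>\<epsilon>. a \<epsilon> \<odot>\<^bsub>E \<epsilon>\<^esub> u \<epsilon>))"
    by (intro SUP_cong refl *)
  also have "\<dots> = cls (\<lambda>\<epsilon>. a \<epsilon> \<odot>\<^bsub>E \<epsilon>\<^esub> u \<epsilon>)"
    using R.net_class_self[OF assms(1)] net_class_self[OF assms(2)] by auto
  finally show ?thesis .
qed

lemma gen_real_carrier: "carrier (gen_real \<rho>) = clsR ` modR"
  using normed_family.carrier_gen_space[OF real_nets] by (simp add: gen_real_def)

lemma gen_real_add:
  "\<lbrakk>x \<in> modR; y \<in> modR\<rbrakk> \<Longrightarrow> clsR x \<oplus>\<^bsub>gen_real \<rho>\<^esub> clsR y = clsR (\<lambda>\<epsilon>. x \<epsilon> + y \<epsilon>)"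
  using normed_family.add_net_class[OF real_nets, of x y] by (simp add: gen_real_def)

text \<open>The ring product is built by the same formula as scalar multiplication over
  \<open>real_nets\<close>, so this is an instance of \<open>smult_net_class\<close>.\<close>

lemma gen_real_mult:
  "\<lbrakk>x \<in> modR; y \<in> modR\<rbrakk> \<Longrightarrow> clsR x \<otimes>\<^bsub>gen_real \<rho>\<^esub> clsR y = clsR (\<lambda>\<epsilon>. x \<epsilon> * y \<epsilon>)"
  using normed_family.smult_net_class[OF real_nets, of x y] by (simp add: gen_real_def gen_space_def)

lemma real_class_eqI:
  assumes "x \<in> modR" "y \<in> modR" "(\<lambda>\<epsilon>. x \<epsilon> - y \<epsilon>) \<in> negR"
  shows "clsR x = clsR y"
  by (rule normed_family.net_class_eqI[OF real_nets]) (use assms in \<open>simp add: net_rel_def\<close>)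

text \<open>The quantifiers over representatives collapse to a single negligible error between fixed
  ones, since changing either representative only alters that error.\<close>

lemma gen_le_iff:
  assumes x: "x \<in> modR" and y: "y \<in> modR"
  shows "gen_le (clsR x) (clsR y) \<longleftrightarrow> (\<exists>z\<in>negR. \<forall>\<^sub>F \<epsilon> in at_right 0. x \<epsilon> \<le> y \<epsilon> + z \<epsilon>)"
proof
  interpret R: normed_family \<rho> real_nets by (rule real_nets)
  assume "gen_le (clsR x) (clsR y)"
  then obtain y' where y': "y' \<in> clsR y" "\<forall>\<^sub>F \<epsilon> in at_right 0. x \<epsilon> \<le> y' \<epsilon>"
    using R.net_class_self[OF x] by (auto simp: gen_le_def)
  then have "(\<lambda>\<epsilon>. \<bar>y \<epsilon> - y' \<epsilon>\<bar>) \<in> negR"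
    using R.net_relD(3) by (auto simp: R.mem_net_class)
  moreover have "\<forall>\<^sub>F \<epsilon> in at_right 0. x \<epsilon> \<le> y \<epsilon> + \<bar>y \<epsilon> - y' \<epsilon>\<bar>"
    using y'(2) by eventually_elim linarith
  ultimately show "\<exists>z\<in>negR. \<forall>\<^sub>F \<epsilon> in at_right 0. x \<epsilon> \<le> y \<epsilon> + z \<epsilon>"
    by (intro bexI[of _ "\<lambda>\<epsilon>. \<bar>y \<epsilon> - y' \<epsilon>\<bar>"])
next
  interpret R: normed_family \<rho> real_nets by (rule real_nets)
  assume "\<exists>z\<in>negR. \<forall>\<^sub>F \<epsilon> in at_right 0. x \<epsilon> \<le> y \<epsilon> + z \<epsilon>"
  then obtain z where z: "z \<in> negR" "\<forall>\<^sub>F \<epsilon> in at_right 0. x \<epsilon> \<le> y \<epsilon> + z \<epsilon>" by blast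
  show "gen_le (clsR x) (clsR y)"
    unfolding gen_le_def
  proof
    fix x' assume "x' \<in> clsR x"
    then have neg: "(\<lambda>\<epsilon>. z \<epsilon> + \<bar>x \<epsilon> - x' \<epsilon>\<bar>) \<in> negR"
      using R.net_relD(3) z(1) by (auto simp: R.mem_net_class intro!: negligible_real_add)
    \<comment> \<open>This representative of the larger class absorbs both the error
      \<open>z\<close> and the passage from \<open>x\<close> to \<open>x'\<close>.\<close>
    let ?y = "\<lambda>\<epsilon>. y \<epsilon> + (z \<epsilon> + \<bar>x \<epsilon> - x' \<epsilon>\<bar>)"
    have "(y, ?y) \<in> net_rel \<rho> real_nets"
      by (rule R.net_relI[OF y moderate_real_add[OF y negligible_real_imp_moderate[OF neg]]
            negligible_real_abs[OF neg]]) (simp add: abs_minus_commute)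
    moreover have "\<forall>\<^sub>F \<epsilon> in at_right 0. x' \<epsilon> \<le> ?y \<epsilon>"
      using z(2) by eventually_elim linarith
    ultimately show "\<exists>y'\<in>clsR y. \<forall>\<^sub>F \<epsilon> in at_right 0. x' \<epsilon> \<le> y' \<epsilon>"
      by (auto simp: R.mem_net_class)
  qed
qed

text \<open>By linearity, compatibility with differences in \<open>represents\<close> follows once
  negligible nets are sent to negligible nets.\<close>

lemma linear_functional_of_net:
  assumes lin: "\<And>\<epsilon>. \<epsilon> \<in> idx \<Longrightarrow> linear_functional real_line (E \<epsilon>) (carrier (E \<epsilon>)) (fe \<epsilon>)"
    and mod: "\<And>u. u \<in> modE \<Longrightarrow> (\<lambda>\<epsilon>. fe \<epsilon> (u \<epsilon>)) \<in> modR"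
    and neg: "\<And>u. u \<in> negE \<Longrightarrow> (\<lambda>\<epsilon>. fe \<epsilon> (u \<epsilon>)) \<in> negR"
  obtains f where "represents \<rho> E (\<lambda>\<epsilon>. carrier (E \<epsilon>)) fe f"
    "linear_functional (gen_real \<rho>) (gen_space \<rho> E) (carrier (gen_space \<rho> E)) f"
proof -
  interpret R: normed_family \<rho> real_nets by (rule real_nets)
  define f where "f U = (\<Union>u\<in>U. clsR (\<lambda>\<epsilon>. fe \<epsilon> (u \<epsilon>)))" for U
  have add: "fe \<epsilon> (x \<oplus>\<^bsub>E \<epsilon>\<^esub> y) = fe \<epsilon> x + fe \<epsilon> y"
    if "\<epsilon> \<in> idx" "x \<in> carrier (E \<epsilon>)" "y \<in> carrier (E \<epsilon>)" for \<epsilon> x y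
    using lin[OF that(1)] that by (simp add: linear_functional_def)
  have smult: "fe \<epsilon> (a \<odot>\<^bsub>E \<epsilon>\<^esub> x) = a * fe \<epsilon> x" if "\<epsilon> \<in> idx" "x \<in> carrier (E \<epsilon>)" for \<epsilon> a x
    using lin[OF that(1)] that by (simp add: linear_functional_def)
  have diff: "fe \<epsilon> (x \<ominus>\<^bsub>E \<epsilon>\<^esub> y) = fe \<epsilon> x - fe \<epsilon> y"
    if "\<epsilon> \<in> idx" "x \<in> carrier (E \<epsilon>)" "y \<in> carrier (E \<epsilon>)" for \<epsilon> x y
  proof -
    interpret normed_space "E \<epsilon>" by (rule space[OF that(1)])
    show ?thesis
      using add[OF that(1), of x "\<ominus>\<^bsub>E \<epsilon>\<^esub> y"] smult[OF that(1,3), of "-1"] that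
      by (simp add: a_minus_def smult_minus_one)
  qed
  have neg_diff: "(\<lambda>\<epsilon>. fe \<epsilon> (u \<epsilon>) - fe \<epsilon> (v \<epsilon>)) \<in> negR"
    if "u \<in> modE" "v \<in> modE" "(\<lambda>\<epsilon>. u \<epsilon> \<ominus>\<^bsub>E \<epsilon>\<^esub> v \<epsilon>) \<in> negE" for u v
    by (rule negligible_real_mono[OF neg[OF that(3)]], rule eventually_mono[OF eventually_idx])
      (simp add: diff moderate_carrier that)
  have f_class: "f (cls u) = clsR (\<lambda>\<epsilon>. fe \<epsilon> (u \<epsilon>))" if "u \<in> modE" for u
    unfolding f_def
  proof (rule Union_net_class[OF that])
    fix v assume "(u, v) \<in> net_rel \<rho> E"
    then show "clsR (\<lambda>\<epsilon>. fe \<epsilon> (v \<epsilon>)) = clsR (\<lambda>\<epsilon>. fe \<epsilon> (u \<epsilon>))"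
      unfolding net_rel_def by (intro real_class_eqI[symmetric] mod neg_diff) auto
  qed
  \<comment> \<open>Linearity of \<open>fe \<epsilon>\<close> is known on \<open>idx\<close> only,
    so the nets to be compared agree there and possibly nowhere else.\<close>
  have eq: "clsR x = clsR y" if "x \<in> modR" "y \<in> modR" "\<And>\<epsilon>. \<epsilon> \<in> idx \<Longrightarrow> x \<epsilon> = y \<epsilon>" for x y
    by (rule R.net_class_eqI, rule R.net_rel_eventually_eq[OF that(1,2)],
        rule eventually_mono[OF eventually_idx]) (rule that(3))
  show thesis
  proof
    show "represents \<rho> E (\<lambda>\<epsilon>. carrier (E \<epsilon>)) fe f"
      unfolding represents_def using mod neg_diff f_class by auto
    show "linear_functional (gen_real \<rho>) (gen_space \<rho> E) (carrier (gen_space \<rho> E)) f"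
      unfolding linear_functional_def
    proof (intro conjI ballI funcsetI)
      fix U assume "U \<in> carrier (gen_space \<rho> E)"
      then obtain u where u: "u \<in> modE" "U = cls u" by (auto simp: carrier_gen_space)
      show "f U \<in> carrier (gen_real \<rho>)"
        using u mod by (simp add: f_class gen_real_carrier)
      {
        fix V assume "V \<in> carrier (gen_space \<rho> E)"
        then obtain v where v: "v \<in> modE" "V = cls v" by (auto simp: carrier_gen_space)
        show "f (U \<oplus>\<^bsub>gen_space \<rho> E\<^esub> V) = f U \<oplus>\<^bsub>gen_real \<rho>\<^esub> f V"
          using u v by (simp add: add_net_class f_class moderate_add gen_real_add mod)
            (intro eq mod moderate_add moderate_real_add add moderate_carrier)
      }
      {
        fix A assume "A \<in> carrier (gen_real \<rho>)"
        then obtain a where a: "a \<in> modR" "A = clsR a" by (auto simp: gen_real_carrier)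
        show "f (A \<odot>\<^bsub>gen_space \<rho> E\<^esub> U) = A \<otimes>\<^bsub>gen_real \<rho>\<^esub> f U"
          using u a by (simp add: smult_net_class f_class moderate_smult gen_real_mult mod)
            (intro eq mod moderate_smult moderate_real_mult smult moderate_carrier)
      }
    qed
  qed
qed

end

section \<open>Extension of functionals with representatives\<close>

context normed_family
begin

text \<open>
  For each \<open>N\<close> a single net, chosen to violate the bound \<open>\<rho> \<epsilon> ^ N\<close> wherever this is possible at
  all, makes the pointwise hypothesis uniform.
\<close>

lemma negligible_unit_ball_bound:
  assumes sub: "\<And>\<epsilon>. \<epsilon> \<in> idx \<Longrightarrow> D \<epsilon> \<subseteq> carrier (E \<epsilon>)"
    and zero: "\<And>\<epsilon>. \<epsilon> \<in> idx \<Longrightarrow> \<zero>\<^bsub>E \<epsilon>\<^esub> \<in> D \<epsilon> \<and> 0 \<le> h \<epsilon> \<zero>\<^bsub>E \<epsilon>\<^esub>"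
    and h: "\<And>u. u \<in> modE \<inter> Pi idx D \<Longrightarrow> \<exists>z\<in>negR. \<forall>\<^sub>F \<epsilon> in at_right 0. h \<epsilon> (u \<epsilon>) \<le> z \<epsilon>"
  obtains d where "d \<in> negR" "\<forall>\<^sub>F \<epsilon> in at_right 0. 0 \<le> d \<epsilon>"
    "\<forall>\<^sub>F \<epsilon> in at_right 0. \<forall>x\<in>D \<epsilon>. nrm (E \<epsilon>) x \<le> 1 \<longrightarrow> h \<epsilon> x \<le> d \<epsilon>"
proof -
  define B where "B \<epsilon> = {x \<in> D \<epsilon>. nrm (E \<epsilon>) x \<le> 1}" for \<epsilon>
  have zero_B: "\<zero>\<^bsub>E \<epsilon>\<^esub> \<in> B \<epsilon>" if "\<epsilon> \<in> idx" for \<epsilon>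
    using zero[OF that] normed_space.nrm_zero[OF space[OF that]] by (simp add: B_def)
  have unif: "\<forall>\<^sub>F \<epsilon> in at_right 0. \<forall>x\<in>B \<epsilon>. h \<epsilon> x \<le> \<rho> \<epsilon> ^ N" for N
  proof -
    \<comment> \<open>If some vector of the ball violates the bound, it is the witness; otherwise
      zero is. The implication makes the choice possible at every \<epsilon>.\<close>
    have "\<forall>\<epsilon>\<in>idx. \<exists>x\<in>B \<epsilon>. \<forall>y\<in>B \<epsilon>. h \<epsilon> x \<le> \<rho> \<epsilon> ^ N \<longrightarrow> h \<epsilon> y \<le> \<rho> \<epsilon> ^ N"
      using zero_B by meson
    then obtain u where u: "\<And>\<epsilon>. \<epsilon> \<in> idx \<Longrightarrow> u \<epsilon> \<in> B \<epsilon>"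
      "\<And>\<epsilon> y. \<lbrakk>\<epsilon> \<in> idx; y \<in> B \<epsilon>; h \<epsilon> (u \<epsilon>) \<le> \<rho> \<epsilon> ^ N\<rbrakk> \<Longrightarrow> h \<epsilon> y \<le> \<rho> \<epsilon> ^ N"
      by metis
    have "u \<in> modE"
      by (rule moderate_mono[OF _ moderate_real_one]) (use u(1) sub in \<open>force simp: B_def\<close>)+
    then have "u \<in> modE \<inter> Pi idx D" using u(1) by (auto simp: B_def)
    then obtain z where z: "z \<in> negR" "\<forall>\<^sub>F \<epsilon> in at_right 0. h \<epsilon> (u \<epsilon>) \<le> z \<epsilon>" using h by blast
    have "\<forall>\<^sub>F \<epsilon> in at_right 0. \<bar>z \<epsilon>\<bar> \<le> \<rho> \<epsilon> ^ N"
      using z(1) by (simp add: negligible_real_iff_eventually)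
    with z(2) eventually_idx show ?thesis
      by eventually_elim (use u(2) in force)
  qed
  define d where "d \<epsilon> = (SUP x\<in>B \<epsilon>. h \<epsilon> x)" for \<epsilon>
  have d_upper: "\<forall>\<^sub>F \<epsilon> in at_right 0. \<forall>x\<in>B \<epsilon>. h \<epsilon> x \<le> d \<epsilon>"
    \<comment> \<open>Exponent 0 already bounds \<open>h \<epsilon>\<close> by 1 on the ball, so the
      supremum is a genuine one for small \<epsilon>.\<close>
    using unif[of 0]
  proof eventually_elim
    case (elim \<epsilon>)
    then have "bdd_above (h \<epsilon> ` B \<epsilon>)" by (intro bdd_aboveI2) auto
    then show ?case by (auto simp: d_def intro: cSUP_upper)
  qed
  \<comment> \<open>The zero vector lies in the ball and \<open>h \<epsilon>\<close> is nonnegative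
    there.\<close>
  have d_nonneg: "\<forall>\<^sub>F \<epsilon> in at_right 0. 0 \<le> d \<epsilon>"
    using d_upper eventually_idx by eventually_elim (use zero zero_B order_trans in blast)
  have "\<forall>\<^sub>F \<epsilon> in at_right 0. \<bar>d \<epsilon>\<bar> \<le> \<rho> \<epsilon> ^ N" for N
    using unif[of N] d_nonneg eventually_idx
  proof eventually_elim
    case (elim \<epsilon>)
    then have "d \<epsilon> \<le> \<rho> \<epsilon> ^ N"
      unfolding d_def using zero_B by (intro cSUP_least) auto
    then show ?case using elim by simp
  qed
  then have "d \<in> negR" by (simp add: negligible_real_iff_eventually)
  moreover have "\<forall>\<^sub>F \<epsilon> in at_right 0. \<forall>x\<in>D \<epsilon>. nrm (E \<epsilon>) x \<le> 1 \<longrightarrow> h \<epsilon> x \<le> d \<epsilon>"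
    using d_upper by eventually_elim (simp add: B_def)
  ultimately show thesis using d_nonneg that by blast
qed

text \<open>This is the passage from errors depending on the net to one net of extensions. It speaks
  of nets only; classes enter afterwards.\<close>

lemma Hahn_Banach_nets:
  assumes pe: "\<And>\<epsilon>. \<epsilon> \<in> idx \<Longrightarrow> sublinear_functional real_line {0<..} (\<le>) (E \<epsilon>) (pe \<epsilon>)"
    and p_mod: "\<And>u. u \<in> modE \<Longrightarrow> (\<lambda>\<epsilon>. pe \<epsilon> (u \<epsilon>)) \<in> modR"
    and p_neg: "\<And>u. u \<in> negE \<Longrightarrow> (\<lambda>\<epsilon>. pe \<epsilon> (u \<epsilon>)) \<in> negR"
    and Fe: "\<And>\<epsilon>. \<epsilon> \<in> idx \<Longrightarrow> submodule (Fe \<epsilon>) real_line (E \<epsilon>)"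
    and ge: "\<And>\<epsilon>. \<epsilon> \<in> idx \<Longrightarrow> linear_functional real_line (E \<epsilon>) (Fe \<epsilon>) (ge \<epsilon>)"
    and dom: "\<And>u. u \<in> modE \<inter> Pi idx Fe \<Longrightarrow>
      \<exists>z\<in>negR. \<forall>\<^sub>F \<epsilon> in at_right 0. ge \<epsilon> (u \<epsilon>) - pe \<epsilon> (u \<epsilon>) \<le> z \<epsilon>"
  obtains fe where
    "\<And>\<epsilon>. \<epsilon> \<in> idx \<Longrightarrow> linear_functional real_line (E \<epsilon>) (carrier (E \<epsilon>)) (fe \<epsilon>)"
    "\<And>u. u \<in> modE \<Longrightarrow> (\<lambda>\<epsilon>. fe \<epsilon> (u \<epsilon>)) \<in> modR"
    "\<And>u. u \<in> negE \<Longrightarrow> (\<lambda>\<epsilon>. fe \<epsilon> (u \<epsilon>)) \<in> negR"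
    "\<forall>\<^sub>F \<epsilon> in at_right 0. \<forall>x\<in>Fe \<epsilon>. fe \<epsilon> x = ge \<epsilon> x"
    "\<And>u. u \<in> modE \<Longrightarrow> \<exists>z\<in>negR. \<forall>\<^sub>F \<epsilon> in at_right 0. fe \<epsilon> (u \<epsilon>) \<le> pe \<epsilon> (u \<epsilon>) + z \<epsilon>"
proof -
  have Fe_sub: "Fe \<epsilon> \<subseteq> carrier (E \<epsilon>)" and Fe_zero: "\<zero>\<^bsub>E \<epsilon>\<^esub> \<in> Fe \<epsilon>" if "\<epsilon> \<in> idx" for \<epsilon>
    using subgroup.subset[OF submodule.axioms(1)[OF Fe[OF that]]]
      subgroup.one_closed[OF submodule.axioms(1)[OF Fe[OF that]]] by auto
  have zero: "ge \<epsilon> \<zero>\<^bsub>E \<epsilon>\<^esub> = 0" "pe \<epsilon> \<zero>\<^bsub>E \<epsilon>\<^esub> = 0" if "\<epsilon> \<in> idx" for \<epsilon>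
  proof -
    interpret normed_space "E \<epsilon>" by (rule space[OF that])
    have "ge \<epsilon> (a \<odot>\<^bsub>E \<epsilon>\<^esub> \<zero>\<^bsub>E \<epsilon>\<^esub>) = a * ge \<epsilon> \<zero>\<^bsub>E \<epsilon>\<^esub>" for a
      using ge[OF that] Fe_zero[OF that] unfolding linear_functional_def real_line_simps by blast
    from this[of 0] show "ge \<epsilon> \<zero>\<^bsub>E \<epsilon>\<^esub> = 0" by simp
    show "pe \<epsilon> \<zero>\<^bsub>E \<epsilon>\<^esub> = 0" by (rule sublinear_zero[OF pe[OF that]])
  qed
  obtain d where d: "d \<in> negR" "\<forall>\<^sub>F \<epsilon> in at_right 0. 0 \<le> d \<epsilon>"
    "\<forall>\<^sub>F \<epsilon> in at_right 0. \<forall>x\<in>Fe \<epsilon>. nrm (E \<epsilon>) x \<le> 1 \<longrightarrow> ge \<epsilon> x - pe \<epsilon> x \<le> d \<epsilon>"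
    by (rule negligible_unit_ball_bound[of Fe "\<lambda>\<epsilon> x. ge \<epsilon> x - pe \<epsilon> x"])
      (use Fe_sub Fe_zero zero dom in auto)
  define good where "good \<epsilon> \<longleftrightarrow> \<epsilon> \<in> idx \<and> 0 \<le> d \<epsilon> \<and>
    (\<forall>x\<in>Fe \<epsilon>. nrm (E \<epsilon>) x \<le> 1 \<longrightarrow> ge \<epsilon> x - pe \<epsilon> x \<le> d \<epsilon>)" for \<epsilon>
  have good: "\<forall>\<^sub>F \<epsilon> in at_right 0. good \<epsilon>"
    using eventually_idx d(2,3) by eventually_elim (simp add: good_def)
  \<comment> \<open>Linearity is required at every index, as representatives must be linear
    throughout; extension and domination can only be asked at good \<epsilon>, and elsewhere the
    zero functional serves.\<close>
  let ?Q = "\<lambda>\<epsilon> f. linear_functional real_line (E \<epsilon>) (carrier (E \<epsilon>)) f \<and>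
    (good \<epsilon> \<longrightarrow> (\<forall>x\<in>Fe \<epsilon>. f x = ge \<epsilon> x) \<and>
      (\<forall>x\<in>carrier (E \<epsilon>). f x \<le> pe \<epsilon> x + d \<epsilon> * nrm (E \<epsilon>) x))"
  have "\<forall>\<epsilon>\<in>idx. \<exists>f. ?Q \<epsilon> f"
  proof
    fix \<epsilon> assume idx: "\<epsilon> \<in> idx"
    show "\<exists>f. ?Q \<epsilon> f"
    proof (cases "good \<epsilon>")
      case True
      interpret normed_space "E \<epsilon>" by (rule space[OF idx])
      obtain f where "linear_functional real_line (E \<epsilon>) (carrier (E \<epsilon>)) f"
        "\<And>x. x \<in> Fe \<epsilon> \<Longrightarrow> f x = ge \<epsilon> x"
        "\<And>x. x \<in> carrier (E \<epsilon>) \<Longrightarrow> f x \<le> pe \<epsilon> x + d \<epsilon> * nrm (E \<epsilon>) x"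
        by (rule Hahn_Banach_defect[OF pe[OF idx] Fe[OF idx] ge[OF idx], of "d \<epsilon>"])
          (use True in \<open>auto simp: good_def\<close>)
      then show ?thesis by blast
    next
      case False
      then show ?thesis by (intro exI[of _ "\<lambda>_. 0"]) (simp add: linear_functional_def)
    qed
  qed
  from bchoice[of idx ?Q, OF this] obtain fe where fe: "\<forall>\<epsilon>\<in>idx. ?Q \<epsilon> (fe \<epsilon>)" ..
  have lin: "linear_functional real_line (E \<epsilon>) (carrier (E \<epsilon>)) (fe \<epsilon>)" if "\<epsilon> \<in> idx" for \<epsilon>
    using fe that by blast
  have ext: "fe \<epsilon> x = ge \<epsilon> x" if "good \<epsilon>" "x \<in> Fe \<epsilon>" for \<epsilon> x
    using fe that unfolding good_def by blast
  have le: "fe \<epsilon> x \<le> pe \<epsilon> x + d \<epsilon> * nrm (E \<epsilon>) x" if "good \<epsilon>" "x \<in> carrier (E \<epsilon>)" for \<epsilon> x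
    using fe that unfolding good_def by blast
  \<comment> \<open>Domination at \<open>u \<epsilon>\<close> bounds
    \<open>fe \<epsilon> (u \<epsilon>)\<close> from above, domination at its negative from below;
    \<open>?b\<close> majorises both bounds. It is moderate or negligible along with
    \<open>u\<close>.\<close>
  let ?b = "\<lambda>u \<epsilon>. \<bar>pe \<epsilon> (u \<epsilon>)\<bar> + \<bar>pe \<epsilon> (\<ominus>\<^bsub>E \<epsilon>\<^esub> u \<epsilon>)\<bar> + \<bar>nrm (E \<epsilon>) (u \<epsilon>) * d \<epsilon>\<bar>"
  have bound: "\<forall>\<^sub>F \<epsilon> in at_right 0. \<bar>fe \<epsilon> (u \<epsilon>)\<bar> \<le> \<bar>?b u \<epsilon>\<bar>" if "u \<in> modE" for u
    using good
  proof eventually_elim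
    case (elim \<epsilon>)
    then have idx: "\<epsilon> \<in> idx" by (simp add: good_def)
    interpret normed_space "E \<epsilon>" by (rule space[OF idx])
    have u: "u \<epsilon> \<in> carrier (E \<epsilon>)" using that idx by (rule moderate_carrier)
    have "fe \<epsilon> ((-1) \<odot>\<^bsub>E \<epsilon>\<^esub> u \<epsilon>) = (-1) * fe \<epsilon> (u \<epsilon>)"
      using lin[OF idx] u by (simp add: linear_functional_def)
    then have "fe \<epsilon> (\<ominus>\<^bsub>E \<epsilon>\<^esub> u \<epsilon>) = - fe \<epsilon> (u \<epsilon>)" using u by (simp add: smult_minus_one)
    then have "- fe \<epsilon> (u \<epsilon>) \<le> pe \<epsilon> (\<ominus>\<^bsub>E \<epsilon>\<^esub> u \<epsilon>) + nrm (E \<epsilon>) (u \<epsilon>) * d \<epsilon>"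
      using le[OF elim, of "\<ominus>\<^bsub>E \<epsilon>\<^esub> u \<epsilon>"] u by (simp add: nrm_uminus mult.commute)
    moreover have "fe \<epsilon> (u \<epsilon>) \<le> pe \<epsilon> (u \<epsilon>) + nrm (E \<epsilon>) (u \<epsilon>) * d \<epsilon>"
      using le[OF elim u] by (simp add: mult.commute)
    ultimately show ?case by linarith
  qed
  have d_nrm: "(\<lambda>\<epsilon>. nrm (E \<epsilon>) (u \<epsilon>) * d \<epsilon>) \<in> negR" if "u \<in> modE" for u
    by (rule negligible_real_mult[OF moderate_nrm[OF that] d(1)])
  show thesis
  proof (rule that[OF lin])
    show "(\<lambda>\<epsilon>. fe \<epsilon> (u \<epsilon>)) \<in> modR" if "u \<in> modE" for u
      by (rule moderate_real_mono[OF _ bound[OF that]])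
        (intro moderate_real_add moderate_real_abs p_mod moderate_uminus
          negligible_real_imp_moderate d_nrm that)
    show "(\<lambda>\<epsilon>. fe \<epsilon> (u \<epsilon>)) \<in> negR" if "u \<in> negE" for u
      by (rule negligible_real_mono[OF _ bound[OF negligible_imp_moderate[OF that]]])
        (intro negligible_real_add negligible_real_abs p_neg negligible_uminus
          d_nrm negligible_imp_moderate that)
    show "\<forall>\<^sub>F \<epsilon> in at_right 0. \<forall>x\<in>Fe \<epsilon>. fe \<epsilon> x = ge \<epsilon> x"
      using good by eventually_elim (simp add: ext)
    show "\<exists>z\<in>negR. \<forall>\<^sub>F \<epsilon> in at_right 0. fe \<epsilon> (u \<epsilon>) \<le> pe \<epsilon> (u \<epsilon>) + z \<epsilon>" if "u \<in> modE" for u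
    proof (rule bexI[OF _ d_nrm[OF that]])
      show "\<forall>\<^sub>F \<epsilon> in at_right 0. fe \<epsilon> (u \<epsilon>) \<le> pe \<epsilon> (u \<epsilon>) + nrm (E \<epsilon>) (u \<epsilon>) * d \<epsilon>"
        using good eventually_idx
        by eventually_elim (use le that moderate_carrier in \<open>force simp: mult.commute\<close>)
    qed
  qed
qed

text \<open>An internal set asks for membership in \<open>D \<epsilon>\<close> at small \<epsilon>
  only, whereas \<open>represents\<close> speaks of nets lying in \<open>D\<close> on all of
  \<open>idx\<close>. Replacing the stray values by zero bridges the gap without enlarging
  norms.\<close>

lemma internal_set_representative:
  assumes U: "U \<in> internal_set \<rho> E D" and zero: "\<And>\<epsilon>. \<epsilon> \<in> idx \<Longrightarrow> \<zero>\<^bsub>E \<epsilon>\<^esub> \<in> D \<epsilon>"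
  obtains u where "u \<in> modE \<inter> Pi idx D" "U = cls u"
proof -
  obtain w where "w \<in> modE" "U = cls w"
    using U by (auto simp: internal_set_def carrier_gen_space)
  moreover obtain v where "v \<in> U" and v: "\<forall>\<^sub>F \<epsilon> in at_right 0. v \<epsilon> \<in> D \<epsilon>"
    using U by (auto simp: internal_set_def)
  ultimately have rel: "(w, v) \<in> net_rel \<rho> E" by (simp add: mem_net_class)
  define u where "u \<epsilon> = (if v \<epsilon> \<in> D \<epsilon> then v \<epsilon> else \<zero>\<^bsub>E \<epsilon>\<^esub>)" for \<epsilon>
  note v_mod = net_relD(2)[OF rel]
  have u_mod: "u \<in> modE"
  proof (rule moderate_mono[OF _ moderate_real_abs[OF moderate_nrm[OF v_mod]]])
    show "nrm (E \<epsilon>) (u \<epsilon>) \<le> \<bar>nrm (E \<epsilon>) (v \<epsilon>)\<bar>" if "\<epsilon> \<in> idx" for \<epsilon>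
      using normed_space.nrm_zero[OF space[OF that]] by (simp add: u_def abs_ge_self)
  qed (use v_mod moderate_carrier closed(1) in
      \<open>simp add: u_def Pi_iff del: greaterThanAtMost_iff\<close>)
  have "(v, u) \<in> net_rel \<rho> E"
    by (rule net_rel_eventually_eq[OF v_mod u_mod], rule eventually_mono[OF v]) (simp add: u_def)
  then have "U = cls u"
    using net_class_eqI[OF rel] net_class_eqI \<open>U = cls w\<close> by simp
  moreover have "u \<in> Pi idx D" using zero by (auto simp: u_def)
  ultimately show thesis using that u_mod by blast
qed

lemma net_class_in_internal_set:
  assumes "u \<in> modE" "u \<in> Pi idx D"
  shows "cls u \<in> internal_set \<rho> E D"
proof -
  have "\<forall>\<^sub>F \<epsilon> in at_right 0. u \<epsilon> \<in> D \<epsilon>"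
    using eventually_idx by eventually_elim (use assms(2) in blast)
  then have "\<exists>v\<in>cls u. \<forall>\<^sub>F \<epsilon> in at_right 0. v \<epsilon> \<in> D \<epsilon>"
    using net_class_self[OF assms(1)] by blast
  then show ?thesis using assms(1) by (simp add: internal_set_def carrier_gen_space)
qed

end

theorem theorem4:
  fixes \<rho> :: "real \<Rightarrow> real"
    and E :: "real \<Rightarrow> 'a nspace"
    and Fe :: "real \<Rightarrow> 'a set"
    and F :: "(real \<Rightarrow> 'a) set set"
    and p g :: "(real \<Rightarrow> 'a) set \<Rightarrow> (real \<Rightarrow> real) set"
  assumes "\<rho> \<in> idx \<rightarrow> idx"
    and "(\<rho> \<longlongrightarrow> 0) (at_right 0)"
    and "\<And>\<epsilon>. \<epsilon> \<in> idx \<Longrightarrow> normed_space (E \<epsilon>)"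
    and "submodule F (gen_real \<rho>) (gen_space \<rho> E)"
    and "sublinear_functional (gen_real \<rho>) (gen_pos \<rho>) gen_le (gen_space \<rho> E) p"
    and "linear_functional (gen_real \<rho>) (gen_space \<rho> E) F g"
    and "\<And>x. x \<in> F \<Longrightarrow> gen_le (g x) (p x)"
    and "\<And>\<epsilon>. \<epsilon> \<in> idx \<Longrightarrow> submodule (Fe \<epsilon>) real_line (E \<epsilon>)"
    and "F = internal_set \<rho> E Fe"
    and "has_sublinear_representatives \<rho> E p"
    and "has_linear_representatives \<rho> E Fe g"
  shows "\<exists>f. linear_functional (gen_real \<rho>) (gen_space \<rho> E) (carrier (gen_space \<rho> E)) f \<and>
           has_linear_representatives \<rho> E (\<lambda>\<epsilon>. carrier (E \<epsilon>)) f \<and>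
           (\<forall>x\<in>F. f x = g x) \<and>
           (\<forall>x\<in>carrier (gen_space \<rho> E). gen_le (f x) (p x))"
proof -
  interpret normed_family \<rho> E
    using assms(1-3) by (simp add: normed_family_def gauge_def normed_family_axioms_def)
  obtain pe where pe: "\<And>\<epsilon>. \<epsilon> \<in> idx \<Longrightarrow> sublinear_functional real_line {0<..} (\<le>) (E \<epsilon>) (pe \<epsilon>)"
    and p: "represents \<rho> E (\<lambda>\<epsilon>. carrier (E \<epsilon>)) pe p"
    using assms(10) unfolding has_sublinear_representatives_def by blast
  obtain ge where ge: "\<And>\<epsilon>. \<epsilon> \<in> idx \<Longrightarrow> linear_functional real_line (E \<epsilon>) (Fe \<epsilon>) (ge \<epsilon>)"
    and g: "represents \<rho> E Fe ge g"
    using assms(11) unfolding has_linear_representatives_def by blast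
  have modE_Pi: "modE \<inter> (\<Pi> \<epsilon>\<in>idx. carrier (E \<epsilon>)) = modE" unfolding moderate_def by blast
  note p = p[unfolded represents_def modE_Pi] and g = g[unfolded represents_def]
  have p_mod: "(\<lambda>\<epsilon>. pe \<epsilon> (u \<epsilon>)) \<in> modR" and p_cls: "p (cls u) = clsR (\<lambda>\<epsilon>. pe \<epsilon> (u \<epsilon>))"
    if "u \<in> modE" for u using p that by auto
  have g_mod: "(\<lambda>\<epsilon>. ge \<epsilon> (u \<epsilon>)) \<in> modR" and g_cls: "g (cls u) = clsR (\<lambda>\<epsilon>. ge \<epsilon> (u \<epsilon>))"
    if "u \<in> modE \<inter> Pi idx Fe" for u using g that by auto
  \<comment> \<open>As \<open>pe \<epsilon>\<close> is not linear, negligibility is obtained by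
    comparing \<open>u\<close> with the zero net, where \<open>pe \<epsilon>\<close>
    vanishes.\<close>
  have p_neg: "(\<lambda>\<epsilon>. pe \<epsilon> (u \<epsilon>)) \<in> negR" if u: "u \<in> negE" for u
  proof -
    have "\<forall>\<^sub>F \<epsilon> in at_right 0. nrm (E \<epsilon>) (u \<epsilon> \<ominus>\<^bsub>E \<epsilon>\<^esub> \<zero>\<^bsub>E \<epsilon>\<^esub>) \<le> nrm (E \<epsilon>) (u \<epsilon>)"
      using eventually_idx
    proof eventually_elim
      case (elim \<epsilon>)
      interpret normed_space "E \<epsilon>" by (rule space[OF elim])
      show ?case
        using negligible_carrier[OF u elim] nrm_uminus[of "\<zero>\<^bsub>E \<epsilon>\<^esub>"]
          nrm_triangle[of "u \<epsilon>" "\<ominus>\<^bsub>E \<epsilon>\<^esub> \<zero>\<^bsub>E \<epsilon>\<^esub>"] by (simp add: a_minus_def)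
    qed
    then have "(\<lambda>\<epsilon>. u \<epsilon> \<ominus>\<^bsub>E \<epsilon>\<^esub> \<zero>\<^bsub>E \<epsilon>\<^esub>) \<in> negE"
      by (rule negligible_mono[OF _ negligible_nrm[OF u], rotated])
        (auto intro!: closed negligible_carrier[OF u])
    then have diff: "(\<lambda>\<epsilon>. pe \<epsilon> (u \<epsilon>) - pe \<epsilon> \<zero>\<^bsub>E \<epsilon>\<^esub>) \<in> negR"
      by (rule p[THEN conjunct2, THEN conjunct1, rule_format,
            OF negligible_imp_moderate[OF u] moderate_zero])
    have zero: "pe \<epsilon> \<zero>\<^bsub>E \<epsilon>\<^esub> = 0" if "\<epsilon> \<in> idx" for \<epsilon>
    proof -
      interpret normed_space "E \<epsilon>" by (rule space[OF that])
      show ?thesis by (rule sublinear_zero[OF pe[OF that]])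
    qed
    show ?thesis
      by (rule negligible_real_mono[OF diff], rule eventually_mono[OF eventually_idx])
        (simp add: zero)
  qed
  have Fe_zero: "\<zero>\<^bsub>E \<epsilon>\<^esub> \<in> Fe \<epsilon>" if "\<epsilon> \<in> idx" for \<epsilon>
    using subgroup.one_closed[OF submodule.axioms(1)[OF assms(8)[OF that]]] by simp
  \<comment> \<open>Here the inequality between classes becomes one between nets: internality puts
    the class of \<open>u\<close> into \<open>F\<close>. The error \<open>z\<close> still depends on
    \<open>u\<close>.\<close>
  have dom: "\<exists>z\<in>negR. \<forall>\<^sub>F \<epsilon> in at_right 0. ge \<epsilon> (u \<epsilon>) - pe \<epsilon> (u \<epsilon>) \<le> z \<epsilon>"
    if u: "u \<in> modE \<inter> Pi idx Fe" for u
  proof -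
    have "gen_le (clsR (\<lambda>\<epsilon>. ge \<epsilon> (u \<epsilon>))) (clsR (\<lambda>\<epsilon>. pe \<epsilon> (u \<epsilon>)))"
      using assms(7)[of "cls u"] net_class_in_internal_set[of u Fe] u p_cls[of u] g_cls[of u]
      by (simp add: assms(9))
    then obtain z where "z \<in> negR" "\<forall>\<^sub>F \<epsilon> in at_right 0. ge \<epsilon> (u \<epsilon>) \<le> pe \<epsilon> (u \<epsilon>) + z \<epsilon>"
      using u g_mod p_mod by (subst (asm) gen_le_iff) auto
    then show ?thesis
      by (intro bexI[of _ z]) (auto elim: eventually_mono simp: algebra_simps)
  qed
  obtain fe where
    lin: "\<And>\<epsilon>. \<epsilon> \<in> idx \<Longrightarrow> linear_functional real_line (E \<epsilon>) (carrier (E \<epsilon>)) (fe \<epsilon>)" and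
    f_mod: "\<And>u. u \<in> modE \<Longrightarrow> (\<lambda>\<epsilon>. fe \<epsilon> (u \<epsilon>)) \<in> modR" and
    f_neg: "\<And>u. u \<in> negE \<Longrightarrow> (\<lambda>\<epsilon>. fe \<epsilon> (u \<epsilon>)) \<in> negR" and
    f_ext: "\<forall>\<^sub>F \<epsilon> in at_right 0. \<forall>x\<in>Fe \<epsilon>. fe \<epsilon> x = ge \<epsilon> x" and
    f_le: "\<And>u. u \<in> modE \<Longrightarrow> \<exists>z\<in>negR. \<forall>\<^sub>F \<epsilon> in at_right 0. fe \<epsilon> (u \<epsilon>) \<le> pe \<epsilon> (u \<epsilon>) + z \<epsilon>"
    by (rule Hahn_Banach_nets[OF pe p_mod p_neg assms(8) ge dom]) blast+
  obtain f where rep: "represents \<rho> E (\<lambda>\<epsilon>. carrier (E \<epsilon>)) fe f" and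
    f_lin: "linear_functional (gen_real \<rho>) (gen_space \<rho> E) (carrier (gen_space \<rho> E)) f"
    by (rule linear_functional_of_net[OF lin f_mod f_neg])
  have f_cls: "f (cls u) = clsR (\<lambda>\<epsilon>. fe \<epsilon> (u \<epsilon>))" if "u \<in> modE" for u
    using rep that unfolding represents_def modE_Pi by blast
  have "f x = g x" if "x \<in> F" for x
  proof -
    \<comment> \<open>A representative with values in \<open>Fe\<close> is needed on both sides:
      \<open>ge\<close> represents \<open>g\<close> along such nets, and \<open>fe\<close> agrees
      with \<open>ge\<close> on \<open>Fe \<epsilon>\<close> for small \<epsilon>.\<close>
    obtain u where u: "u \<in> modE \<inter> Pi idx Fe" "x = cls u"
      by (rule internal_set_representative[OF \<open>x \<in> F\<close>[unfolded assms(9)] Fe_zero])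
    have "(\<lambda>\<epsilon>. fe \<epsilon> (u \<epsilon>) - ge \<epsilon> (u \<epsilon>)) \<in> negR"
    proof (rule negligible_real_zero)
      show "\<forall>\<^sub>F \<epsilon> in at_right 0. fe \<epsilon> (u \<epsilon>) - ge \<epsilon> (u \<epsilon>) = 0"
        using f_ext eventually_idx by eventually_elim (use u(1) in auto)
    qed
    then have "clsR (\<lambda>\<epsilon>. fe \<epsilon> (u \<epsilon>)) = clsR (\<lambda>\<epsilon>. ge \<epsilon> (u \<epsilon>))"
      using u f_mod g_mod by (intro real_class_eqI) auto
    then show ?thesis using u by (simp add: f_cls g_cls)
  qed
  moreover have "gen_le (f x) (p x)" if "x \<in> carrier (gen_space \<rho> E)" for x
  proof -
    obtain u where u: "u \<in> modE" "x = cls u" using \<open>x \<in> _\<close> by (auto simp: carrier_gen_space)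
    then show ?thesis using f_le by (simp add: f_cls p_cls gen_le_iff f_mod p_mod)
  qed
  moreover have "has_linear_representatives \<rho> E (\<lambda>\<epsilon>. carrier (E \<epsilon>)) f"
    using lin rep unfolding has_linear_representatives_def by blast
  ultimately show ?thesis using f_lin by blast
qed

end
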